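(* Let $p=4500\,e_5-220\,e_1e_4+7\,e_1^2e_3\in\mathbb{R}[x_1,\dots,x_5]$. Then $p$ is symmetric hyperbolic, the associated operator of $p$ is not extendable, $\Delta_{\vec 1\vec 1}\,p$ is a sum of squares of polynomials, and $p$ is not weakly SOS-hyperbolic.
   Context: $\vec 1=(1,\dots,1)\in\mathbb{R}^5$ and $e_k$ is the $k$-th elementary symmetric polynomial in $x_1,\dots,x_5$. A homogeneous $p\in\mathbb{R}[x_1,\dots,x_n]$ is hyperbolic with respect to $v\in\mathbb{R}^n$ if $p(v)\ne0$ and for every $x\in\mathbb{R}^n$ the univariate polynomial $p(x+tv)$ in $t$ has only real roots. $p$ is symmetric hyperbolic if it is invariant under all permutations of the variables and hyperbolic with respect to $\vec 1$. The hyperbolicity cone is $H_v(p)=\{x\in\mathbb{R}^n: p(x+tv)\ne0\text{ for all }t>0\}$. For $u,w\in\mathbb{R}^n$, $\Delta_{uw}p=D_up\,D_wp-p\,D_{uw}p$, where $D_u$ is the directional derivative in direction $u$ and $D_{uw}=D_uD_w$. $p$ (hyperbolic with respect to $\vec 1$) is weakly SOS-hyperbolic if $\Delta_{uw}p$ is a sum of squares of polynomials for all $u,w\in H_{\vec 1}(p)$. $\mathbb{R}[t]_n$ is the space of real univariate polynomials of degree at most $n$; $\mathbb{R}[t]_{n,0}$ is the subspace of those whose coefficient of $t^{n-1}$ is $0$. The associated operator of $p=\sum_{i=1}^d a_ie_1^{d-i}e_i$ in $n$ variables (here $n=d=5$) is the map $T:\mathbb{R}[t]_{n,0}\to\mathbb{R}[t]_{d,0}$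 given by $T(g)(t)=a\,p(\vec r-t\vec 1)$ if $g=a\prod_{i=1}^n(t-r_i)$ with $a\in\mathbb{R}\setminus\{0\}$ and $\vec r=(r_1,\dots,r_n)\in\mathbb{C}^n$, extended to all of $\mathbb{R}[t]_{n,0}$ by continuity; it is linear and maps $t^{n-k}$ to a multiple of $t^{d-k}$. $T$ is extendable if it is the restriction to $\mathbb{R}[t]_{n,0}$ of a linear map $\hat T:\mathbb{R}[t]_n\to\mathbb{R}[t]_d$ that is diagonal ($\hat T(t^{n-k})=\gamma_kt^{d-k}$ for $0\le k\le d$ and $\hat T(t^{n-k})=0$ for $k>d$, for some $\gamma_k\in\mathbb{R}$) and maps every polynomial with only real roots to a polynomial with only real roots (the zero polynomial and constants count as having only real roots). *)

theory Defs
  imports "HOL-Analysis.Analysis" "HOL-Library.Poly_Mapping"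
    "HOL-Computational_Algebra.Polynomial"
begin

text \<open>Real polynomials in variables indexed by \<open>'n\<close>: finitely supported families of
  coefficients, indexed by exponent vectors. The ring structure is the library's convolution
  product on \<open>poly_mapping\<close>.\<close>

type_synonym 'n mpoly = "('n \<Rightarrow>\<^sub>0 nat) \<Rightarrow>\<^sub>0 real"

definition Const :: "real \<Rightarrow> 'n mpoly" where
  "Const c = Poly_Mapping.single 0 c"

definition Var :: "'n \<Rightarrow> 'n mpoly" where
  "Var i = Poly_Mapping.single (Poly_Mapping.single i 1) 1"

definition esym :: "nat \<Rightarrow> 'n::finite mpoly" where
  "esym k = (\<Sum>S | S \<subseteq> UNIV \<and> card S = k. \<Prod>i\<in>S. Var i)"

text \<open>Substitution \<open>Var i \<mapsto> x i\<close> into a commutative ring, the coefficients being transported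
  by the ring homomorphism \<open>\<phi>\<close>. The rings used below are the reals, \<open>'n mpoly\<close>, and
  univariate real and complex polynomials.\<close>

definition subst :: "(real \<Rightarrow> 'b::comm_ring_1) \<Rightarrow> ('n::finite \<Rightarrow> 'b) \<Rightarrow> 'n mpoly \<Rightarrow> 'b" where
  "subst \<phi> x p = (\<Sum>m\<in>Poly_Mapping.keys p. \<phi> (Poly_Mapping.lookup p m) *
     (\<Prod>i\<in>UNIV. x i ^ Poly_Mapping.lookup m i))"

definition eval :: "'n::finite mpoly \<Rightarrow> real ^ 'n \<Rightarrow> real" where
  "eval p x = subst (\<lambda>c. c) (\<lambda>i. x $ i) p"

text \<open>The truncated subtraction of exponents is harmless: the coefficient vanishes when the
  exponent of \<open>i\<close> is zero.\<close>

definition partial :: "'n \<Rightarrow> 'n mpoly \<Rightarrow> 'n mpoly" where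
  "partial i p = (\<Sum>m\<in>Poly_Mapping.keys p.
     Poly_Mapping.single (m - Poly_Mapping.single i 1)
       (real (Poly_Mapping.lookup m i) * Poly_Mapping.lookup p m))"

definition dir_deriv :: "real ^ 'n \<Rightarrow> 'n::finite mpoly \<Rightarrow> 'n mpoly" where
  "dir_deriv u p = (\<Sum>i\<in>UNIV. Const (u $ i) * partial i p)"

definition homogeneous :: "'n::finite mpoly \<Rightarrow> bool" where
  "homogeneous p \<longleftrightarrow>
     (\<exists>d. \<forall>m\<in>Poly_Mapping.keys p. (\<Sum>i\<in>UNIV. Poly_Mapping.lookup m i) = d)"

definition symmetric :: "'n::finite mpoly \<Rightarrow> bool" where
  "symmetric p \<longleftrightarrow> (\<forall>\<sigma>. \<sigma> permutes UNIV \<longrightarrow> subst Const (\<lambda>i. Var (\<sigma> i)) p = p)"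

definition sos :: "'n mpoly \<Rightarrow> bool" where
  "sos f \<longleftrightarrow> (\<exists>qs. f = (\<Sum>q\<leftarrow>qs. q ^ 2))"

definition real_rooted :: "real poly \<Rightarrow> bool" where
  "real_rooted q \<longleftrightarrow>
     q = 0 \<or> (\<forall>z::complex. poly (map_poly complex_of_real q) z = 0 \<longrightarrow> z \<in> \<real>)"

text \<open>The second conjunct concerns the univariate polynomial \<open>p(x + t v)\<close> in \<open>t\<close>.\<close>

definition hyperbolic :: "real ^ 'n \<Rightarrow> 'n::finite mpoly \<Rightarrow> bool" where
  "hyperbolic v p \<longleftrightarrow> homogeneous p \<and> eval p v \<noteq> 0 \<and>
     (\<forall>x. real_rooted (subst (\<lambda>c. [:c:]) (\<lambda>i. [:x $ i, v $ i:]) p))"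

definition symmetric_hyperbolic :: "'n::finite mpoly \<Rightarrow> bool" where
  "symmetric_hyperbolic p \<longleftrightarrow> symmetric p \<and> hyperbolic 1 p"

definition hyperbolicity_cone :: "real ^ 'n \<Rightarrow> 'n::finite mpoly \<Rightarrow> (real ^ 'n) set" where
  "hyperbolicity_cone v p = {x. \<forall>t>0. eval p (x + t *\<^sub>R v) \<noteq> 0}"

definition Delta :: "real ^ 'n \<Rightarrow> real ^ 'n \<Rightarrow> 'n::finite mpoly \<Rightarrow> 'n mpoly" where
  "Delta u w p = dir_deriv u p * dir_deriv w p - p * dir_deriv u (dir_deriv w p)"

definition weakly_sos_hyperbolic :: "'n::finite mpoly \<Rightarrow> bool" where
  "weakly_sos_hyperbolic p \<longleftrightarrow> hyperbolic 1 p \<and>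
     (\<forall>u \<in> hyperbolicity_cone 1 p. \<forall>w \<in> hyperbolicity_cone 1 p. sos (Delta u w p))"

text \<open>\<open>polys n\<close> is \<open>\<real>[t]\<^sub>n\<close>; \<open>polys0 n\<close> is \<open>\<real>[t]\<^sub>n\<^sub>,\<^sub>0\<close>, meant for \<open>n \<ge> 1\<close>.\<close>

definition polys :: "nat \<Rightarrow> real poly set" where
  "polys n = {g. degree g \<le> n}"

definition polys0 :: "nat \<Rightarrow> real poly set" where
  "polys0 n = {g \<in> polys n. coeff g (n - 1) = 0}"

text \<open>\<open>is_associated_operator d p T\<close>: the restriction of \<open>T\<close> to \<open>polys0 n\<close>, where
  \<open>n = CARD('n)\<close>, is the operator associated with \<open>p\<close>, of degree \<open>d\<close>; values of \<open>T\<close> elsewhere are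
  irrelevant. The second conjunct is the formula \<open>T(g)(t) = a p(r - t 1)\<close> for
  \<open>g = a \<Prod>\<^sub>i (t - r\<^sub>i)\<close>, read in \<open>\<complex>[t]\<close>. The third is continuity: convergence in the
  finite-dimensional spaces \<open>polys0 n\<close> and \<open>polys0 d\<close> is convergence of all coefficients, and
  sequential continuity is continuity. Since the polynomials of exact degree \<open>n\<close> are dense in
  \<open>polys0 n\<close>, \<open>T\<close> is determined on \<open>polys0 n\<close>.\<close>

definition is_associated_operator ::
    "nat \<Rightarrow> 'n::finite mpoly \<Rightarrow> (real poly \<Rightarrow> real poly) \<Rightarrow> bool" where
  "is_associated_operator d p T \<longleftrightarrow>
     T \<in> polys0 CARD('n) \<rightarrow> polys0 d \<and>
     (\<forall>g \<in> polys0 CARD('n). \<forall>(a::real) (r::complex ^ 'n).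
        a \<noteq> 0 \<longrightarrow>
        map_poly complex_of_real g = smult (complex_of_real a) (\<Prod>i\<in>UNIV. [:- (r $ i), 1:]) \<longrightarrow>
        map_poly complex_of_real (T g) =
          smult (complex_of_real a)
            (subst (\<lambda>c. [:complex_of_real c:]) (\<lambda>i. [:r $ i, -1:]) p)) \<and>
     (\<forall>G. \<forall>g \<in> polys0 CARD('n).
        (\<forall>k::nat. G k \<in> polys0 CARD('n)) \<longrightarrow>
        (\<forall>j. (\<lambda>k. coeff (G k) j) \<longlonglongrightarrow> coeff g j) \<longrightarrow>
        (\<forall>j. (\<lambda>k. coeff (T (G k)) j) \<longlonglongrightarrow> coeff (T g) j))"

text \<open>As for \<open>T\<close>, only the values of \<open>T'\<close> on \<open>polys n\<close> matter.\<close>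

definition extendable :: "nat \<Rightarrow> nat \<Rightarrow> (real poly \<Rightarrow> real poly) \<Rightarrow> bool" where
  "extendable n d T \<longleftrightarrow> (\<exists>T'.
     T' \<in> polys n \<rightarrow> polys d \<and>
     (\<forall>g \<in> polys n. \<forall>h \<in> polys n. T' (g + h) = T' g + T' h) \<and>
     (\<forall>c. \<forall>g \<in> polys n. T' (smult c g) = smult c (T' g)) \<and>
     (\<exists>\<gamma>::nat \<Rightarrow> real. \<forall>k\<le>n.
        T' (monom 1 (n - k)) = (if k \<le> d then monom (\<gamma> k) (d - k) else 0)) \<and>
     (\<forall>g \<in> polys n. real_rooted g \<longrightarrow> real_rooted (T' g)) \<and>
     (\<forall>g \<in> polys0 n. T' g = T g))"

end

theory Submission
  imports Defs "HOL-Computational_Algebra.Fundamental_Theorem_Algebra"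
begin

text \<open>Write \<open>f(s) = p(x + s 1)\<close>. Then \<open>\<bar>f(\<i> b)\<bar>\<^sup>2\<close> is a polynomial in \<open>b\<^sup>2\<close> whose coefficients
  are the Laguerre expressions of \<open>f\<close> at \<open>0\<close>; the first nontrivial one is the Rayleigh difference in
  direction \<open>1\<close>. Each of them is a sum of squares by an explicit symmetric identity, so \<open>f\<close> has
  only real roots, which gives hyperbolicity and the sum of squares statement together.

  The associated operator is diagonal and fixes all but one coefficient of an extension. The
  remaining coefficient is excluded by the Laguerre inequality \<open>(n - 1) q'\<^sup>2 \<ge> n q q''\<close> applied to
  three images of products of \<open>t\<close> and \<open>t + 1\<close>.

  For weak SOS-hyperbolicity take \<open>u = w = (6,1,1,1,1)\<close>, a boundary point of the cone. Restricted to
  \<open>x = (0,a,b,c,d)\<close>, the Rayleigh difference is a form of degree \<open>8\<close> with many zeros, such as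
  \<open>(7,1,1,1)\<close> and its permutations. Every quartic \<open>q\<close> with \<open>q\<^sup>2\<close> below this form therefore satisfies
  linear conditions that force \<open>q(1,h,-h,0) = O(h\<^sup>2)\<close>, whereas the form itself is
  \<open>2058 h\<^sup>2 + O(h\<^sup>4)\<close> there.\<close>

section \<open>Polynomial rings\<close>


lemma exhaust_5: "x = 0 \<or> x = 1 \<or> x = 2 \<or> x = 3 \<or> x = 4" for x :: 5
proof (induct x)
  case (of_int z)
  then have "z = 0 \<or> z = 1 \<or> z = 2 \<or> z = 3 \<or> z = 4" by fastforce
  then show ?case by auto
qed

lemma UNIV_5: "(UNIV :: 5 set) = {0, 1, 2, 3, 4}"
  using exhaust_5 by auto

lemma sum_UNIV_5: "sum f (UNIV :: 5 set) = f 0 + f 1 + f 2 + f 3 + f 4"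
  unfolding UNIV_5 by (simp add: add.assoc)

lemma prod_UNIV_5: "prod f (UNIV :: 5 set) = f 0 * f 1 * f 2 * f 3 * f 4"
  unfolding UNIV_5 by (simp add: mult.assoc)

section \<open>Expansion of polynomials into monomials\<close>

lemma mpoly_eq_sum_monomials:
  "p = (\<Sum>m\<in>Poly_Mapping.keys p. Poly_Mapping.single m (Poly_Mapping.lookup p m))"
  for p :: "'n mpoly"
proof (rule poly_mapping_eqI)
  fix k
  have "(\<Sum>m\<in>Poly_Mapping.keys p. Poly_Mapping.lookup p m when m = k) = Poly_Mapping.lookup p k"
    by (simp add: when_def in_keys_iff)
  then show "Poly_Mapping.lookup p k = Poly_Mapping.lookup
      (\<Sum>m\<in>Poly_Mapping.keys p. Poly_Mapping.single m (Poly_Mapping.lookup p m)) k"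
    by (simp add: lookup_sum lookup_single)
qed

text \<open>For statements additive in \<open>p\<close> it suffices to add one monomial at a time.
  Multiplicativity of substitution and the Leibniz rule thereby reduce to products of two
  monomials.\<close>

lemma mpoly_monomial_induct [case_names zero add]:
  fixes p :: "'n mpoly"
  assumes "P 0" and "\<And>m c q. P q \<Longrightarrow> P (Poly_Mapping.single m c + q)"
  shows "P p"
proof -
  have "P (\<Sum>m\<in>A. Poly_Mapping.single m (Poly_Mapping.lookup p m))" if "finite A" for A
    using that by induction (auto intro: assms)
  then show ?thesis
    by (subst mpoly_eq_sum_monomials) simp
qed

lemma Const_add: "Const (a + b) = Const a + Const b"
  by (simp add: Const_def single_add)

lemma Const_mult: "Const (a * b) = Const a * Const b"
  by (simp add: Const_def mult_single)

lemma Const_0 [simp]: "Const 0 = 0"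
  and Const_1 [simp]: "Const 1 = 1"
  by (simp_all add: Const_def)

lemma numeral_eq_Const: "numeral k = Const (numeral k)"
  by (simp add: Const_def)

section \<open>Substitution as a ring homomorphism\<close>

locale coeff_hom =
  fixes \<phi> :: "real \<Rightarrow> 'b::comm_ring_1"
  assumes hom_0: "\<phi> 0 = 0" and hom_1: "\<phi> 1 = 1"
    and hom_add: "\<phi> (a + b) = \<phi> a + \<phi> b"
    and hom_mult: "\<phi> (a * b) = \<phi> a * \<phi> b"
begin

abbreviation term_at :: "('n::finite \<Rightarrow> 'b) \<Rightarrow> ('n \<Rightarrow>\<^sub>0 nat) \<Rightarrow> real \<Rightarrow> 'b" where
  "term_at x m c \<equiv> \<phi> c * (\<Prod>i\<in>UNIV. x i ^ Poly_Mapping.lookup m i)"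

text \<open>Since \<open>\<phi> 0 = 0\<close>, extra exponents contribute nothing. Additivity needs
  such a common index set, because terms may cancel in a sum.\<close>

lemma subst_superset:
  assumes "finite A" "Poly_Mapping.keys p \<subseteq> A"
  shows "subst \<phi> x p = (\<Sum>m\<in>A. term_at x m (Poly_Mapping.lookup p m))"
  unfolding subst_def using assms
  by (intro sum.mono_neutral_left) (auto simp: in_keys_iff hom_0)

lemma subst_add: "subst \<phi> x (p + q) = subst \<phi> x p + subst \<phi> x q"
proof -
  let ?A = "Poly_Mapping.keys p \<union> Poly_Mapping.keys q"
  have "subst \<phi> x (p + q) = (\<Sum>m\<in>?A. term_at x m (Poly_Mapping.lookup (p + q) m))"
    using keys_add[of p q] by (intro subst_superset) auto
  also have "\<dots> = (\<Sum>m\<in>?A. term_at x m (Poly_Mapping.lookup p m)) +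
      (\<Sum>m\<in>?A. term_at x m (Poly_Mapping.lookup q m))"
    by (simp add: lookup_add hom_add sum.distrib distrib_right)
  finally show ?thesis
    using subst_superset[of ?A p x] subst_superset[of ?A q x] by simp
qed

lemma subst_0 [simp]: "subst \<phi> x 0 = 0"
  by (simp add: subst_def hom_0)

lemma subst_single: "subst \<phi> x (Poly_Mapping.single m c) = term_at x m c"
  using subst_superset[of "{m}" "Poly_Mapping.single m c" x] by (simp add: hom_0)

lemma subst_single_mult_single:
  "subst \<phi> x (Poly_Mapping.single m c * Poly_Mapping.single k d) =
    subst \<phi> x (Poly_Mapping.single m c) * subst \<phi> x (Poly_Mapping.single k d)"
  by (simp add: mult_single subst_single lookup_add power_add prod.distrib hom_mult mult_ac)

lemma subst_mult: "subst \<phi> x (p * q) = subst \<phi> x p * subst \<phi> x q"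
proof (induction p rule: mpoly_monomial_induct)
  case (add m c p)
  have "subst \<phi> x (Poly_Mapping.single m c * q) =
      subst \<phi> x (Poly_Mapping.single m c) * subst \<phi> x q"
    by (induction q rule: mpoly_monomial_induct)
      (simp_all add: distrib_left subst_add subst_single_mult_single)
  with add show ?case by (simp add: distrib_right subst_add)
qed simp

lemma subst_Const: "subst \<phi> x (Const c) = \<phi> c"
  by (simp add: Const_def subst_single hom_1)

lemma subst_1 [simp]: "subst \<phi> x 1 = 1"
  using subst_Const[of x 1] by (simp add: hom_1)

lemma subst_uminus: "subst \<phi> x (- p) = - subst \<phi> x p"
  using subst_add[of x p "- p"] by (simp add: eq_neg_iff_add_eq_0 add.commute)

lemma subst_diff: "subst \<phi> x (p - q) = subst \<phi> x p - subst \<phi> x q"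
  using subst_add[of x p "- q"] by (simp add: subst_uminus)

lemma hom_numeral: "\<phi> (numeral k) = numeral k"
  by (induction k) (simp_all only: numeral.simps hom_add hom_1)

lemma subst_numeral: "subst \<phi> x (numeral k) = numeral k"
  by (simp add: numeral_eq_Const subst_Const hom_numeral)

lemma subst_power: "subst \<phi> x (p ^ k) = subst \<phi> x p ^ k"
  by (induction k) (simp_all add: subst_mult)

lemma subst_sum: "subst \<phi> x (sum f A) = (\<Sum>a\<in>A. subst \<phi> x (f a))"
  by (induction A rule: infinite_finite_induct) (simp_all add: subst_add)

lemma subst_prod: "subst \<phi> x (prod f A) = (\<Prod>a\<in>A. subst \<phi> x (f a))"
  by (induction A rule: infinite_finite_induct) (simp_all add: subst_mult)

lemma subst_sum_list: "subst \<phi> x (sum_list ps) = (\<Sum>p\<leftarrow>ps. subst \<phi> x p)"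
  by (induction ps) (simp_all add: subst_add)

lemma subst_Var: "subst \<phi> x (Var i) = x i"
proof -
  have "(\<Prod>j\<in>UNIV. x j ^ Poly_Mapping.lookup (Poly_Mapping.single i 1) j) =
      (\<Prod>j\<in>UNIV. if j = i then x j else 1)"
    by (intro prod.cong) (auto simp: lookup_single when_def)
  then show ?thesis
    by (simp add: Var_def subst_single hom_1)
qed

end

section \<open>Elementary symmetric functions over commutative rings\<close>

definition elem_sym :: "nat \<Rightarrow> ('n::finite \<Rightarrow> 'a::comm_ring_1) \<Rightarrow> 'a" where
  "elem_sym k x = (\<Sum>S | S \<subseteq> UNIV \<and> card S = k. \<Prod>i\<in>S. x i)"

lemma esym_eq_elem_sym: "esym k = elem_sym k Var"
  by (simp add: esym_def elem_sym_def)

lemma (in coeff_hom) subst_elem_sym: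
  "subst \<phi> x (elem_sym k y) = elem_sym k (\<lambda>i. subst \<phi> x (y i))"
  by (simp add: elem_sym_def subst_sum subst_prod)

text \<open>Taking images under \<open>\<sigma>\<close> permutes the index sets of size
  \<open>k\<close>.\<close>

lemma elem_sym_permute:
  fixes x :: "'n::finite \<Rightarrow> 'a::comm_ring_1"
  assumes "\<sigma> permutes UNIV"
  shows "elem_sym k (\<lambda>i. x (\<sigma> i)) = elem_sym k x"
proof -
  have inj: "inj \<sigma>" and surj: "surj \<sigma>"
    using permutes_inj[OF assms] permutes_surj[OF assms] by auto
  have card_im: "card (f ` S) = card S" if "inj f" for f :: "'n \<Rightarrow> 'n" and S
    using that by (intro card_image) (rule inj_on_subset[OF _ subset_UNIV])
  have inv: "inj (inv \<sigma>)"
    using surj by (rule surj_imp_inj_inv)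
  have "bij_betw ((`) \<sigma>) {S. S \<subseteq> UNIV \<and> card S = k} {S. S \<subseteq> UNIV \<and> card S = k}"
    by (rule bij_betw_byWitness[where f' = "(`) (inv \<sigma>)"])
      (auto simp: card_im inj inv image_image surj_f_inv_f[OF surj] inv_f_f[OF inj])
  from sum.reindex_bij_betw[OF this, of "prod x"]
  have "(\<Sum>S | S \<subseteq> UNIV \<and> card S = k. prod x (\<sigma> ` S)) = elem_sym k x"
    by (simp add: elem_sym_def)
  moreover have "prod x (\<sigma> ` S) = (\<Prod>i\<in>S. x (\<sigma> i))" for S
    using inj_on_subset[OF inj subset_UNIV] by (simp add: prod.reindex)
  ultimately show ?thesis
    by (simp add: elem_sym_def)
qed

definition elem_sym_on :: "'n set \<Rightarrow> nat \<Rightarrow> ('n \<Rightarrow> 'a::comm_ring_1) \<Rightarrow> 'a" where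
  "elem_sym_on A k x = (\<Sum>S | S \<subseteq> A \<and> card S = k. \<Prod>i\<in>S. x i)"

text \<open>A subset of size \<open>Suc k\<close> either avoids \<open>a\<close> or arises by
  inserting \<open>a\<close> into a subset of \<open>A\<close> of size \<open>k\<close>. Iterating
  this recursion gives the explicit formulas in five variables.\<close>

lemma elem_sym_on_insert:
  fixes x :: "'n \<Rightarrow> 'a::comm_ring_1"
  assumes "finite A" "a \<notin> A"
  shows "elem_sym_on (insert a A) (Suc k) x = elem_sym_on A (Suc k) x + x a * elem_sym_on A k x"
proof -
  have fin: "finite S" if "S \<subseteq> A" for S using that assms(1) by (rule finite_subset)
  have split: "{S. S \<subseteq> insert a A \<and> card S = Suc k} =
      {S. S \<subseteq> A \<and> card S = Suc k} \<union> insert a ` {S. S \<subseteq> A \<and> card S = k}" (is "?L = ?R")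
  proof
    show "?L \<subseteq> ?R"
    proof
      fix S assume S: "S \<in> ?L"
      show "S \<in> ?R"
      proof (cases "a \<in> S")
        case True
        then have "S = insert a (S - {a})" "S - {a} \<subseteq> A" using S by auto
        moreover have "card (S - {a}) = k" using True S by simp
        ultimately show ?thesis by blast
      qed (use S in auto)
    qed
    show "?R \<subseteq> ?L"
      using assms fin by (auto simp: card_insert_if)
  qed
  have disj: "{S. S \<subseteq> A \<and> card S = Suc k} \<inter> insert a ` {S. S \<subseteq> A \<and> card S = k} = {}"
    using assms by auto
  have inj: "inj_on (insert a) {S. S \<subseteq> A \<and> card S = k}"
    using assms by (intro inj_onI) (metis (no_types, lifting) mem_Collect_eq insert_ident subsetD)
  have "(\<Sum>S\<in>insert a ` {S. S \<subseteq> A \<and> card S = k}. \<Prod>i\<in>S. x i) =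
      (\<Sum>S | S \<subseteq> A \<and> card S = k. \<Prod>i\<in>insert a S. x i)"
    using inj by (simp add: sum.reindex)
  also have "\<dots> = (\<Sum>S | S \<subseteq> A \<and> card S = k. x a * (\<Prod>i\<in>S. x i))"
    using assms fin by (intro sum.cong refl prod.insert) auto
  finally show ?thesis
    unfolding elem_sym_on_def split using assms(1) disj
    by (subst sum.union_disjoint) (auto simp: sum_distrib_left)
qed

lemma elem_sym_on_0:
  assumes "finite A"
  shows "elem_sym_on A 0 x = 1"
proof -
  have "{S. S \<subseteq> A \<and> card S = 0} = {{}}"
    using assms finite_subset by (auto simp: card_eq_0_iff)
  then show ?thesis by (simp add: elem_sym_on_def)
qed

lemma elem_sym_on_empty:
  "elem_sym_on {} (Suc k) x = 0"
  unfolding elem_sym_on_def by (intro sum.neutral) auto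

lemma elem_sym_on_UNIV: "elem_sym k x = elem_sym_on UNIV k x"
  by (simp add: elem_sym_def elem_sym_on_def)

context
  fixes x :: "5 \<Rightarrow> 'a::comm_ring_1"
begin

lemma elem_sym_5_1: "elem_sym (Suc 0) x = x 0 + x 1 + x 2 + x 3 + x 4"
  and elem_sym_5_2: "elem_sym 2 x = x 0 * x 1 + x 0 * x 2 + x 0 * x 3 + x 0 * x 4 + x 1 * x 2
    + x 1 * x 3 + x 1 * x 4 + x 2 * x 3 + x 2 * x 4 + x 3 * x 4"
  and elem_sym_5_3: "elem_sym 3 x = x 0 * x 1 * x 2 + x 0 * x 1 * x 3 + x 0 * x 1 * x 4
    + x 0 * x 2 * x 3 + x 0 * x 2 * x 4 + x 0 * x 3 * x 4 + x 1 * x 2 * x 3 + x 1 * x 2 * x 4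
    + x 1 * x 3 * x 4 + x 2 * x 3 * x 4"
  and elem_sym_5_4: "elem_sym 4 x = x 0 * x 1 * x 2 * x 3 + x 0 * x 1 * x 2 * x 4
    + x 0 * x 1 * x 3 * x 4 + x 0 * x 2 * x 3 * x 4 + x 1 * x 2 * x 3 * x 4"
  and elem_sym_5_5: "elem_sym 5 x = x 0 * x 1 * x 2 * x 3 * x 4"
  unfolding elem_sym_on_UNIV UNIV_5 numeral_eq_Suc pred_numeral_simps BitM.simps
  by (simp_all add: elem_sym_on_insert elem_sym_on_0 elem_sym_on_empty distrib_left add_ac mult_ac)

end

lemmas elem_sym_5 = elem_sym_5_1 elem_sym_5_2 elem_sym_5_3 elem_sym_5_4 elem_sym_5_5

section \<open>Sum of squares identities\<close>

definition pairs :: "(5 \<times> 5) list" where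
  "pairs = [(0, 1), (0, 2), (0, 3), (0, 4), (1, 2), (1, 3), (1, 4), (2, 3), (2, 4), (3, 4)]"

text \<open>\<open>cubA x i\<close> is \<open>\<Sum>\<^sub>j\<^sub>\<noteq>\<^sub>i x\<^sub>i x\<^sub>j (x\<^sub>i + x\<^sub>j)\<close>, \<open>cubB x i\<close> is the sum of the \<open>x\<^sub>i x\<^sub>j x\<^sub>k\<close>, and
  \<open>quaE x i\<close> is \<open>5 \<Prod>\<^sub>j\<^sub>\<noteq>\<^sub>i x\<^sub>j - e\<^sub>4\<close>. Families indexed by \<open>i\<close> are recentred to have sum \<open>0\<close>, and
  families indexed by pairs to have sum \<open>0\<close> over the pairs through each \<open>i\<close>: they then lie in the
  \<open>(4,1)\<close> and \<open>(3,2)\<close> isotypic components of the symmetric group, which makes the Gram matrix of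
  an invariant sum of squares block diagonal. The numerical coefficients below are the entries of
  these blocks; for \<open>laguerre1_identity\<close> they are forced.\<close>

definition cubA :: "(5 \<Rightarrow> 'a::comm_ring_1) \<Rightarrow> 5 \<Rightarrow> 'a" where
  "cubA x i = elem_sym 1 x * x i ^ 2 - 2 * x i ^ 3 + (elem_sym 1 x ^ 2 - 2 * elem_sym 2 x) * x i"

definition cubB :: "(5 \<Rightarrow> 'a::comm_ring_1) \<Rightarrow> 5 \<Rightarrow> 'a" where
  "cubB x i = elem_sym 2 x * x i - elem_sym 1 x * x i ^ 2 + x i ^ 3"

definition quaE :: "(5 \<Rightarrow> 'a::comm_ring_1) \<Rightarrow> 5 \<Rightarrow> 'a" where
  "quaE x i = 5 * (x i ^ 4 - elem_sym 1 x * x i ^ 3 + elem_sym 2 x * x i ^ 2 - elem_sym 3 x * x i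
    + elem_sym 4 x) - elem_sym 4 x"

text \<open>The monomial symmetric function of type (2,1), the sum of \<open>x i ^ 2 * x j\<close>
  over ordered pairs of distinct indices. The \<open>cubA x i\<close> add up to twice this
  value.\<close>

definition symS :: "(5 \<Rightarrow> 'a::comm_ring_1) \<Rightarrow> 'a" where
  "symS x = elem_sym 1 x * elem_sym 2 x - 3 * elem_sym 3 x"

definition cenA :: "(5 \<Rightarrow> 'a::comm_ring_1) \<Rightarrow> 5 \<Rightarrow> 'a" where
  "cenA x i = 5 * cubA x i - 2 * symS x"

definition cenB :: "(5 \<Rightarrow> 'a::comm_ring_1) \<Rightarrow> 5 \<Rightarrow> 'a" where
  "cenB x i = 5 * cubB x i - 3 * elem_sym 3 x"

definition cenC :: "(5 \<Rightarrow> 'a::comm_ring_1) \<Rightarrow> 5 \<Rightarrow> 'a" where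
  "cenC x i = 5 * x i ^ 2 - (elem_sym 1 x ^ 2 - 2 * elem_sym 2 x)"

definition cenL :: "(5 \<Rightarrow> 'a::comm_ring_1) \<Rightarrow> 5 \<Rightarrow> 'a" where
  "cenL x i = 5 * x i - elem_sym 1 x"

definition pairA :: "(5 \<Rightarrow> 'a::comm_ring_1) \<Rightarrow> 5 \<Rightarrow> 5 \<Rightarrow> 'a" where
  "pairA x i j = 6 * (x i * x j * (x i + x j)) - 2 * (cubA x i + cubA x j) + symS x"

definition pairB :: "(5 \<Rightarrow> 'a::comm_ring_1) \<Rightarrow> 5 \<Rightarrow> 5 \<Rightarrow> 'a" where
  "pairB x i j = 6 * (x i * x j * (elem_sym 1 x - x i - x j)) - 4 * (cubB x i + cubB x j)
    + 3 * elem_sym 3 x"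

definition pairQ :: "(5 \<Rightarrow> 'a::comm_ring_1) \<Rightarrow> 5 \<Rightarrow> 5 \<Rightarrow> 'a" where
  "pairQ x i j = 6 * (x i * x j) - 2 * (x i * (elem_sym 1 x - x i) + x j * (elem_sym 1 x - x j))
    + elem_sym 2 x"

text \<open>The Taylor coefficients of \<open>s \<mapsto> pform (x + s 1)\<close> at \<open>0\<close>; the fourth and fifth
  are \<open>750 * elem_sym 1 x\<close> and \<open>750\<close>.\<close>

definition taylor1 :: "(5 \<Rightarrow> 'a::comm_ring_1) \<Rightarrow> 'a" where
  "taylor1 x = 3400 * elem_sym 4 x - 370 * elem_sym 1 x * elem_sym 3 x
    + 21 * elem_sym 1 x ^ 2 * elem_sym 2 x"

definition taylor2 :: "(5 \<Rightarrow> 'a::comm_ring_1) \<Rightarrow> 'a" where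
  "taylor2 x = 2475 * elem_sym 3 x - 450 * elem_sym 1 x * elem_sym 2 x + 42 * elem_sym 1 x ^ 3"

definition taylor3 :: "(5 \<Rightarrow> 'a::comm_ring_1) \<Rightarrow> 'a" where
  "taylor3 x = 1725 * elem_sym 2 x - 390 * elem_sym 1 x ^ 2"

text \<open>The polynomial \<open>p\<close> read over any commutative ring, so that the same
  identities serve for formal polynomials and for real or complex arguments.\<close>

definition pform :: "(5 \<Rightarrow> 'a::comm_ring_1) \<Rightarrow> 'a" where
  "pform x = 4500 * elem_sym 5 x - 220 * elem_sym 1 x * elem_sym 4 x
    + 7 * elem_sym 1 x ^ 2 * elem_sym 3 x"

lemma pairs_sum:
  "(\<Sum>(i, j)\<leftarrow>pairs. f i j) = f 0 1 + f 0 2 + f 0 3 + f 0 4 + f 1 2 + f 1 3 + f 1 4 + f 2 3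
    + f 2 4 + (f 3 4 :: 'a::comm_monoid_add)"
  by (simp add: pairs_def add.assoc)

text \<open>The left side is the coefficient of \<open>b ^ 6\<close> in the squared modulus of
  \<open>f(\<i> b)\<close>. Its invariant block is a binary form in \<open>elem_sym 1 x ^ 2\<close>
  and \<open>elem_sym 2 x\<close>.\<close>

lemma laguerre3_identity:
  fixes x :: "5 \<Rightarrow> 'a::idom"
  shows "taylor3 x ^ 2 - 2 * taylor2 x * (750 * elem_sym 1 x) + 2 * taylor1 x * 750 =
    47100 * (elem_sym 1 x ^ 2) ^ 2 + 2 * (- 138750) * elem_sym 1 x ^ 2 * elem_sym 2 x
      + 455625 * elem_sym 2 x ^ 2
    + (\<Sum>i\<in>UNIV. 39000 * cenC x i ^ 2 + 2 * (- 30450) * cenC x i * (elem_sym 1 x * cenL x i)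
        + 24000 * (elem_sym 1 x * cenL x i) ^ 2)
    + (\<Sum>(i, j)\<leftarrow>pairs. 75000 * pairQ x i j ^ 2)"
  unfolding pairs_sum sum_UNIV_5 taylor1_def taylor2_def taylor3_def cenC_def cenL_def pairQ_def
    elem_sym_5 One_nat_def
  by algebra

text \<open>The coefficient of \<open>b ^ 4\<close>, scaled by 25. The invariant and the (4,1)
  blocks are ternary forms in cubics, the (3,2) block is a binary form.\<close>

lemma laguerre2_identity:
  fixes x :: "5 \<Rightarrow> 'a::idom"
  shows "25 * (taylor2 x ^ 2 + 2 * pform x * (750 * elem_sym 1 x) - 2 * taylor1 x * taylor3 x) =
    (let u = elem_sym 1 x * (elem_sym 1 x ^ 2 - 2 * elem_sym 2 x); v = symS x; w = elem_sym 3 x in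
      31340 * u ^ 2 + 581650 * v ^ 2 + 5100075 * w ^ 2
        + 2 * (- 116940) * u * v + 2 * 245700 * u * w + 2 * (- 1568850) * v * w)
    + (\<Sum>i\<in>UNIV. let u = elem_sym 1 x * cenC x i; v = cenA x i; w = cenB x i in
        638 * u ^ 2 + 35030 * v ^ 2 + 1190000 * w ^ 2
        + 2 * (- 4174) * u * v + 2 * 19000 * u * w + 2 * (- 188000) * v * w)
    + (\<Sum>(i, j)\<leftarrow>pairs. 42000 * pairA x i j ^ 2 + 2 * (- 236750) * pairA x i j * pairB x i j
        + 3425000 * pairB x i j ^ 2)"
  unfolding pairs_sum sum_UNIV_5 taylor1_def taylor2_def taylor3_def cenC_def cenA_def cenB_def
    cubA_def cubB_def symS_def pairA_def pairB_def pform_def Let_def elem_sym_5 One_nat_def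
  by algebra

text \<open>The coefficient of \<open>b ^ 2\<close>, scaled by 120. It vanishes at (6,1,1,1,1),
  where \<open>f\<close> has a double zero, so every \<open>u\<close> and \<open>v\<close> of the
  positive definite blocks must vanish there. This fixes the multiples 16 and 120 of
  \<open>elem_sym 4 x\<close> and 240 and 30 of \<open>quaE x i\<close>.\<close>

lemma laguerre1_identity:
  fixes x :: "5 \<Rightarrow> 'a::idom"
  shows "120 * (taylor1 x ^ 2 - 2 * pform x * taylor2 x) =
    (let u = elem_sym 1 x * elem_sym 3 x - 16 * elem_sym 4 x;
         v = elem_sym 1 x ^ 2 * elem_sym 2 x - 120 * elem_sym 4 x in
      4433250 * u ^ 2 + 2 * (- 282600) * u * v + 18630 * v ^ 2)
    + (\<Sum>i\<in>UNIV. let u = elem_sym 1 x * cenA x i + 240 * quaE x i;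
         v = elem_sym 1 x * cenB x i + 30 * quaE x i in
        696 * u ^ 2 + 2 * (- 10428) * u * v + 181704 * v ^ 2)
    + (\<Sum>(i, j)\<leftarrow>pairs. let u = elem_sym 1 x * pairA x i j; v = elem_sym 1 x * pairB x i j in
        745 * u ^ 2 + 2 * (- 5155) * u * v + 47320 * v ^ 2)"
  unfolding pairs_sum sum_UNIV_5 taylor1_def taylor2_def taylor3_def cenA_def cenB_def quaE_def
    cubA_def cubB_def symS_def pairA_def pairB_def pform_def Let_def elem_sym_5 One_nat_def
  by algebra

lemma pform_shift:
  fixes x :: "5 \<Rightarrow> 'a::idom"
  shows "pform (\<lambda>i. x i + s) = pform x + taylor1 x * s + taylor2 x * s ^ 2 + taylor3 x * s ^ 3
    + 750 * elem_sym 1 x * s ^ 4 + 750 * s ^ 5"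
  unfolding taylor1_def taylor2_def taylor3_def pform_def elem_sym_5 One_nat_def
  by algebra

section \<open>Derivations, homogeneity and symmetry\<close>

lemma partial_single:
  "partial i (Poly_Mapping.single m c) =
    Poly_Mapping.single (m - Poly_Mapping.single i 1) (real (Poly_Mapping.lookup m i) * c)"
  by (cases "c = 0") (simp_all add: partial_def)

lemma partial_superset:
  assumes "finite A" "Poly_Mapping.keys p \<subseteq> A"
  shows "partial i p = (\<Sum>m\<in>A. Poly_Mapping.single (m - Poly_Mapping.single i 1)
    (real (Poly_Mapping.lookup m i) * Poly_Mapping.lookup p m))"
  unfolding partial_def using assms
  by (intro sum.mono_neutral_left) (auto simp: in_keys_iff)

lemma partial_add: "partial i (p + q) = partial i p + partial i q"
proof -
  let ?A = "Poly_Mapping.keys p \<union> Poly_Mapping.keys q"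
  have "Poly_Mapping.keys (p + q) \<subseteq> ?A"
    by (rule keys_add)
  then show ?thesis
    by (subst (1 2 3) partial_superset[where A = ?A])
      (simp_all add: lookup_add distrib_left single_add sum.distrib)
qed

lemma partial_0 [simp]: "partial i 0 = 0"
  by (simp add: partial_def)

lemma single_minus_add_single:
  fixes m k :: "'n \<Rightarrow>\<^sub>0 nat"
  assumes "Poly_Mapping.lookup m i \<noteq> 0"
  shows "m - Poly_Mapping.single i 1 + k = m + k - Poly_Mapping.single i 1"
  by (rule poly_mapping_eqI) (use assms in \<open>auto simp: lookup_add lookup_minus lookup_single when_def\<close>)

text \<open>The three exponents agree wherever the variable \<open>i\<close> really occurs. Where it
  does not, truncated subtraction may give another exponent, but the coefficient is 0.\<close>

lemma partial_single_mult_single: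
  fixes m k :: "'n \<Rightarrow>\<^sub>0 nat"
  shows "partial i (Poly_Mapping.single m c * Poly_Mapping.single k d) =
    partial i (Poly_Mapping.single m c) * Poly_Mapping.single k d +
    Poly_Mapping.single m c * partial i (Poly_Mapping.single k d)"
proof -
  have "Poly_Mapping.single (m - Poly_Mapping.single i 1 + k) (real (Poly_Mapping.lookup m i) * c * d) =
      Poly_Mapping.single (m + k - Poly_Mapping.single i 1) (real (Poly_Mapping.lookup m i) * c * d)"
    using single_minus_add_single[of m i k] by (cases "Poly_Mapping.lookup m i = 0") simp_all
  moreover have "Poly_Mapping.single (m + (k - Poly_Mapping.single i 1)) (c * (real (Poly_Mapping.lookup k i) * d)) =
      Poly_Mapping.single (m + k - Poly_Mapping.single i 1) (c * (real (Poly_Mapping.lookup k i) * d))"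
    using single_minus_add_single[of k i m]
    by (cases "Poly_Mapping.lookup k i = 0") (simp_all add: add.commute)
  ultimately show ?thesis
    by (simp add: mult_single partial_single lookup_add algebra_simps flip: single_add)
qed

lemma partial_mult:
  fixes p q :: "'n mpoly"
  shows "partial i (p * q) = partial i p * q + p * partial i q"
proof (induction p rule: mpoly_monomial_induct)
  case (add m c p)
  have "partial i (Poly_Mapping.single m c * q) =
      partial i (Poly_Mapping.single m c) * q + Poly_Mapping.single m c * partial i q"
    by (induction q rule: mpoly_monomial_induct)
      (simp_all add: distrib_left partial_add partial_single_mult_single)
  with add show ?case by (simp add: algebra_simps partial_add)
qed simp

lemma partial_Const [simp]: "partial i (Const c) = 0"
  by (simp add: Const_def partial_single)

lemma partial_Var: "partial i (Var j) = (if i = j then 1 else 0)"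
  by (simp add: Var_def partial_single lookup_single)

section \<open>Directional derivatives\<close>

lemma dir_deriv_add: "dir_deriv u (p + q) = dir_deriv u p + dir_deriv u q"
  by (simp add: dir_deriv_def partial_add distrib_left sum.distrib)

lemma dir_deriv_mult: "dir_deriv u (p * q) = dir_deriv u p * q + p * dir_deriv u q"
  by (simp add: dir_deriv_def partial_mult distrib_left sum.distrib sum_distrib_left
      sum_distrib_right mult_ac)

lemma dir_deriv_Const [simp]: "dir_deriv u (Const c) = 0"
  by (simp add: dir_deriv_def)

lemma dir_deriv_numeral [simp]: "dir_deriv u (numeral k) = 0"
  by (simp add: numeral_eq_Const)

lemma dir_deriv_Var: "dir_deriv u (Var j) = Const (u $ j)"
proof -
  have "dir_deriv u (Var j) = (\<Sum>i\<in>UNIV. if i = j then Const (u $ i) else 0)"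
    unfolding dir_deriv_def by (intro sum.cong) (auto simp: partial_Var)
  then show ?thesis by simp
qed

lemma dir_deriv_uminus: "dir_deriv u (- p) = - dir_deriv u p"
  using dir_deriv_add[of u p "- p"] dir_deriv_Const[of u 0]
  by (simp add: eq_neg_iff_add_eq_0 add.commute)

lemma dir_deriv_diff: "dir_deriv u (p - q) = dir_deriv u p - dir_deriv u q"
  using dir_deriv_add[of u p "- q"] by (simp add: dir_deriv_uminus)

lemma dir_deriv_power2: "dir_deriv u (p ^ 2) = 2 * p * dir_deriv u p"
proof -
  have "dir_deriv u (p ^ 2) = dir_deriv u p * p + p * dir_deriv u p"
    unfolding power2_eq_square by (rule dir_deriv_mult)
  also have "\<dots> = 2 * p * dir_deriv u p"
    by (subst mult.commute, subst mult.assoc, rule mult_2[symmetric])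
  finally show ?thesis .
qed

lemmas dir_deriv_simps =
  dir_deriv_add dir_deriv_mult dir_deriv_diff dir_deriv_Var dir_deriv_power2


lemma (in coeff_hom) subst_pform: "subst \<phi> x (pform Var) = pform x"
  by (simp add: pform_def subst_add subst_mult subst_diff subst_power subst_numeral
      subst_elem_sym subst_Var)

interpretation eval_hom: coeff_hom "\<lambda>c::real. c"
  by unfold_locales simp_all

interpretation Const_hom: coeff_hom "Const :: real \<Rightarrow> 'n mpoly"
  by unfold_locales (simp_all add: Const_add Const_mult)

interpretation poly_hom: coeff_hom "\<lambda>c::real. [:c:]"
  by unfold_locales simp_all

interpretation cpoly_hom: coeff_hom "\<lambda>c::real. [:complex_of_real c:]"
  by unfold_locales simp_all

lemma eval_pform: "eval (pform Var) x = pform (\<lambda>i. x $ i)"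
  by (simp add: eval_def eval_hom.subst_pform)

section \<open>Homogeneity and symmetry of the polynomial\<close>

definition homogeneous_deg :: "nat \<Rightarrow> 'n::finite mpoly \<Rightarrow> bool" where
  "homogeneous_deg d p \<longleftrightarrow>
    (\<forall>m\<in>Poly_Mapping.keys p. (\<Sum>i\<in>UNIV. Poly_Mapping.lookup m i) = d)"

lemma homogeneous_deg_0 [simp]: "homogeneous_deg d 0"
  by (simp add: homogeneous_deg_def)

lemma homogeneous_deg_add:
  "homogeneous_deg d p \<Longrightarrow> homogeneous_deg d q \<Longrightarrow> homogeneous_deg d (p + q)"
  using keys_add[of p q] by (fastforce simp: homogeneous_deg_def)

lemma homogeneous_deg_uminus: "homogeneous_deg d p \<Longrightarrow> homogeneous_deg d (- p)"
  by (simp add: homogeneous_deg_def)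

lemma homogeneous_deg_diff:
  "homogeneous_deg d p \<Longrightarrow> homogeneous_deg d q \<Longrightarrow> homogeneous_deg d (p - q)"
  using homogeneous_deg_add[of d p "- q"] homogeneous_deg_uminus[of d q] by simp

lemma homogeneous_deg_mult:
  assumes "homogeneous_deg d p" "homogeneous_deg k q"
  shows "homogeneous_deg (d + k) (p * q)"
  unfolding homogeneous_deg_def
proof
  fix m assume "m \<in> Poly_Mapping.keys (p * q)"
  then obtain a b where "m = a + b" "a \<in> Poly_Mapping.keys p" "b \<in> Poly_Mapping.keys q"
    using keys_mult[of p q] by blast
  with assms show "(\<Sum>i\<in>UNIV. Poly_Mapping.lookup m i) = d + k"
    by (simp add: homogeneous_deg_def lookup_add sum.distrib)
qed

lemma homogeneous_deg_numeral: "homogeneous_deg 0 (numeral k)"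
  by (simp add: homogeneous_deg_def numeral_eq_Const Const_def del: single_numeral)

lemma homogeneous_deg_1: "homogeneous_deg 0 1"
  using homogeneous_deg_numeral[of num.One] by simp

lemma homogeneous_deg_sum:
  "(\<And>a. a \<in> A \<Longrightarrow> homogeneous_deg d (f a)) \<Longrightarrow> homogeneous_deg d (sum f A)"
  by (induction A rule: infinite_finite_induct) (simp_all add: homogeneous_deg_add)

lemma homogeneous_deg_prod_Var:
  assumes "finite S"
  shows "homogeneous_deg (card S) (\<Prod>i\<in>S. Var i)"
  using assms
proof induction
  case (insert i S)
  have "homogeneous_deg 1 (Var i)"
    by (simp add: homogeneous_deg_def Var_def lookup_single when_def)
  from homogeneous_deg_mult[OF this insert.IH] insert.hyps show ?case by simp
qed (simp add: homogeneous_deg_1)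

lemma homogeneous_deg_elem_sym: "homogeneous_deg k (elem_sym k Var)"
  unfolding elem_sym_def
  by (rule homogeneous_deg_sum) (use homogeneous_deg_prod_Var in auto)

lemma homogeneous_pform: "homogeneous (pform Var)"
proof -
  note [intro] = homogeneous_deg_elem_sym homogeneous_deg_numeral
  \<comment> \<open>The degrees are written as sums that mirror the products, numerals having degree
    0, so that \<open>homogeneous_deg_mult\<close> applies factor by factor.\<close>
  have "homogeneous_deg (0 + 5) (4500 * elem_sym 5 Var :: 5 mpoly)"
    and "homogeneous_deg (0 + 1 + 4) (220 * elem_sym 1 Var * elem_sym 4 Var :: 5 mpoly)"
    and "homogeneous_deg (0 + (1 + 1) + 3) (7 * elem_sym 1 Var ^ 2 * elem_sym 3 Var :: 5 mpoly)"
    unfolding power2_eq_square by (intro homogeneous_deg_mult; blast)+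
  then have "homogeneous_deg 5 (pform Var)"
    unfolding pform_def by (intro homogeneous_deg_add homogeneous_deg_diff) simp_all
  then show ?thesis
    unfolding homogeneous_def homogeneous_deg_def by blast
qed

lemma symmetric_pform: "symmetric (pform Var)"
  unfolding symmetric_def Const_hom.subst_pform by (simp add: pform_def elem_sym_permute)

section \<open>Sums of squares and hyperbolicity\<close>

lemma sos_0 [simp]: "sos 0"
  unfolding sos_def by (rule exI[of _ "[]"]) simp

lemma sos_add: "sos f \<Longrightarrow> sos g \<Longrightarrow> sos (f + g)"
  unfolding sos_def by (metis map_append sum_list.append)

lemma sos_sum: "(\<And>a. a \<in> A \<Longrightarrow> sos (f a)) \<Longrightarrow> sos (sum f A)"
  by (induction A rule: infinite_finite_induct) (simp_all add: sos_add)

lemma sos_sum_list: "(\<And>a. a \<in> set as \<Longrightarrow> sos (f a)) \<Longrightarrow> sos (\<Sum>a\<leftarrow>as. f a)"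
  by (induction as) (simp_all add: sos_add)

lemma sos_square: "sos (q ^ 2)"
  unfolding sos_def by (rule exI[of _ "[q]"]) simp

text \<open>The square root of \<open>c\<close> is absorbed into each square.\<close>

lemma sos_Const_mult:
  assumes "c \<ge> 0" "sos f"
  shows "sos (Const c * f)"
proof -
  obtain qs where f: "f = (\<Sum>q\<leftarrow>qs. q ^ 2)"
    using assms(2) by (auto simp: sos_def)
  have sq: "Const c * q ^ 2 = (Const (sqrt c) * q) ^ 2" for q
  proof -
    have "(Const (sqrt c) * q) ^ 2 = Const (sqrt c * sqrt c) * q ^ 2"
      unfolding Const_mult by (simp add: power2_eq_square mult_ac)
    then show ?thesis
      using assms(1) by simp
  qed
  have "Const c * (\<Sum>q\<leftarrow>qs. q ^ 2) = (\<Sum>q\<leftarrow>map (\<lambda>q. Const (sqrt c) * q) qs. q ^ 2)"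
    by (induction qs) (simp_all add: distrib_left sq)
  then show ?thesis
    unfolding sos_def f by blast
qed

text \<open>Completing the square leaves \<open>v ^ 2\<close> with the coefficient
  \<open>c - b ^ 2 / a\<close>, which is nonnegative.\<close>

lemma sos_binary_form:
  assumes "a > 0" "b ^ 2 \<le> a * c"
  shows "sos (Const a * u ^ 2 + 2 * Const b * u * v + Const c * v ^ 2)"
proof -
  have "Const a * (u + Const (b / a) * v) ^ 2 + Const (c - b ^ 2 / a) * v ^ 2 =
      Const a * u ^ 2 + 2 * (Const a * Const (b / a)) * u * v
        + (Const a * Const (b / a) * Const (b / a) + Const (c - b ^ 2 / a)) * v ^ 2"
    by (simp add: power2_eq_square algebra_simps)
  also have "\<dots> = Const a * u ^ 2 + 2 * Const b * u * v + Const c * v ^ 2"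
    using assms(1) by (simp add: power2_eq_square flip: Const_mult Const_add)
  finally show ?thesis
    using assms by (metis sos_add sos_Const_mult sos_square less_imp_le diff_ge_0_iff_ge
        pos_divide_le_eq mult.commute)
qed

lemma dir_deriv_1_pform: "dir_deriv 1 (pform Var) = taylor1 Var"
  unfolding pform_def taylor1_def elem_sym_5 One_nat_def
  by (simp add: dir_deriv_simps) algebra

lemma dir_deriv_1_taylor1: "dir_deriv 1 (taylor1 Var) = 2 * taylor2 Var"
  unfolding taylor1_def taylor2_def elem_sym_5 One_nat_def
  by (simp add: dir_deriv_simps) algebra

lemma Delta_1_1_pform: "Delta 1 1 (pform Var) = taylor1 Var ^ 2 - 2 * pform Var * taylor2 Var"
  by (simp add: Delta_def dir_deriv_1_pform dir_deriv_1_taylor1 power2_eq_square)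

lemma Const_uminus: "Const (- c) = - Const c"
  by (simp add: Const_def single_uminus)

lemma sos_binary_form_numeral:
  assumes "numeral l ^ 2 \<le> numeral k * (numeral m :: real)"
  shows "sos (numeral k * u ^ 2 + 2 * (- numeral l) * u * v + numeral m * v ^ 2)"
  using sos_binary_form[of "numeral k" "- numeral l" "numeral m" u v] assms
  by (simp add: Const_uminus numeral_eq_Const[symmetric])

lemma sos_Delta_1_1_pform: "sos (Delta 1 1 (pform Var))"
proof -
  have "sos (120 * (taylor1 Var ^ 2 - 2 * pform Var * taylor2 Var) :: 5 mpoly)"
    unfolding laguerre1_identity Let_def case_prod_beta
    by (rule sos_add[OF sos_add]; intro sos_sum sos_sum_list sos_binary_form_numeral) simp_all
  then have "sos (Const (1 / 120) * (120 * (taylor1 Var ^ 2 - 2 * pform Var * taylor2 Var)) :: 5 mpoly)"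
    by (intro sos_Const_mult) simp_all
  then show ?thesis
    unfolding Delta_1_1_pform mult.assoc[symmetric] numeral_eq_Const[of "num.Bit0 _"]
    by (simp flip: Const_mult)
qed

section \<open>Nonnegativity of the Laguerre expressions\<close>

lemma binary_form_nonneg:
  fixes a :: real
  assumes "a > 0" "b ^ 2 \<le> a * c"
  shows "0 \<le> a * u ^ 2 + 2 * b * u * v + c * v ^ 2"
proof -
  have "a * (a * u ^ 2 + 2 * b * u * v + c * v ^ 2) = (a * u + b * v) ^ 2 + (a * c - b ^ 2) * v ^ 2"
    by (simp add: power2_eq_square algebra_simps)
  also have "\<dots> \<ge> 0"
    using assms by simp
  finally show ?thesis
    using assms(1) by (simp add: zero_le_mult_iff)
qed

text \<open>Multiplying by \<open>a\<close> and completing the square in \<open>u\<close> leaves a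
  binary form in \<open>v, w\<close>, the Schur complement; the assumptions are exactly those of
  \<open>binary_form_nonneg\<close> for it.\<close>

lemma ternary_form_nonneg:
  fixes a :: real
  assumes "a > 0" "a * b - d ^ 2 > 0" "(a * f - d * e) ^ 2 \<le> (a * b - d ^ 2) * (a * c - e ^ 2)"
  shows "0 \<le> a * u ^ 2 + b * v ^ 2 + c * w ^ 2 + 2 * d * u * v + 2 * e * u * w + 2 * f * v * w"
proof -
  have "a * (a * u ^ 2 + b * v ^ 2 + c * w ^ 2 + 2 * d * u * v + 2 * e * u * w + 2 * f * v * w) =
      (a * u + d * v + e * w) ^ 2
      + ((a * b - d ^ 2) * v ^ 2 + 2 * (a * f - d * e) * v * w + (a * c - e ^ 2) * w ^ 2)"
    by (simp add: power2_eq_square algebra_simps)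
  also have "\<dots> \<ge> 0"
    by (intro add_nonneg_nonneg binary_form_nonneg assms) simp
  finally show ?thesis
    using assms(1) by (simp add: zero_le_mult_iff)
qed

lemma sum_list_map_nonneg: "(\<And>a. a \<in> set as \<Longrightarrow> 0 \<le> f a) \<Longrightarrow> 0 \<le> (\<Sum>a\<leftarrow>as. f a :: real)"
  by (induction as) auto

context
  fixes x :: "5 \<Rightarrow> real"
begin

lemma laguerre1_nonneg: "0 \<le> taylor1 x ^ 2 - 2 * pform x * taylor2 x"
proof -
  have "0 \<le> 120 * (taylor1 x ^ 2 - 2 * pform x * taylor2 x)"
    unfolding laguerre1_identity Let_def case_prod_beta
    by (intro add_nonneg_nonneg sum_nonneg sum_list_map_nonneg binary_form_nonneg) simp_all
  then show ?thesis by simp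
qed

lemma laguerre2_nonneg:
  "0 \<le> taylor2 x ^ 2 + 2 * pform x * (750 * elem_sym 1 x) - 2 * taylor1 x * taylor3 x"
proof -
  have "0 \<le> 25 * (taylor2 x ^ 2 + 2 * pform x * (750 * elem_sym 1 x) - 2 * taylor1 x * taylor3 x)"
    unfolding laguerre2_identity Let_def case_prod_beta
    by (intro add_nonneg_nonneg[OF add_nonneg_nonneg] sum_nonneg sum_list_map_nonneg
        binary_form_nonneg ternary_form_nonneg) simp_all
  then show ?thesis by simp
qed

lemma laguerre3_nonneg:
  "0 \<le> taylor3 x ^ 2 - 2 * taylor2 x * (750 * elem_sym 1 x) + 2 * taylor1 x * 750"
  unfolding laguerre3_identity case_prod_beta
  by (intro add_nonneg_nonneg[OF add_nonneg_nonneg] sum_nonneg sum_list_map_nonneg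
      binary_form_nonneg) simp_all

lemma laguerre4_nonneg: "0 \<le> (750 * elem_sym 1 x) ^ 2 - 2 * taylor3 x * 750"
proof -
  \<comment> \<open>The squared differences over all pairs add up to
    \<open>4 * elem_sym 1 x ^ 2 - 10 * elem_sym 2 x\<close>, which absorbs the term in
    \<open>elem_sym 2 x\<close>.\<close>
  have "(750 * elem_sym 1 x) ^ 2 - 2 * taylor3 x * 750 =
      112500 * elem_sym 1 x ^ 2
      + 258750 * (\<Sum>(i, j)\<leftarrow>pairs. (x i - x j) ^ 2)"
    unfolding pairs_sum taylor3_def elem_sym_5 One_nat_def by algebra
  also have "\<dots> \<ge> 0"
    unfolding case_prod_beta by (intro add_nonneg_nonneg mult_nonneg_nonneg sum_list_map_nonneg) simp_all
  finally show ?thesis .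
qed

text \<open>With \<open>f(s) = pform (x + s 1)\<close>, the Laguerre expressions above are the coefficients of
  \<open>\<bar>f(\<i> b)\<bar>\<^sup>2\<close> as a polynomial in \<open>b\<^sup>2\<close>; the leading one is \<open>750\<^sup>2\<close>.\<close>

lemma pform_imaginary_shift_nonzero:
  assumes "b \<noteq> 0"
  shows "pform (\<lambda>i. complex_of_real (x i) + \<i> * of_real b) \<noteq> 0"
proof
  let ?c = "complex_of_real"
  have es: "elem_sym k (\<lambda>i. ?c (x i)) = ?c (elem_sym k x)" for k
    by (simp add: elem_sym_def)
  have coeffs: "pform (\<lambda>i. ?c (x i)) = ?c (pform x)" "taylor1 (\<lambda>i. ?c (x i)) = ?c (taylor1 x)"
    "taylor2 (\<lambda>i. ?c (x i)) = ?c (taylor2 x)" "taylor3 (\<lambda>i. ?c (x i)) = ?c (taylor3 x)"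
    by (simp_all add: pform_def taylor1_def taylor2_def taylor3_def es)
  \<comment> \<open>Even powers of \<open>\<i> * b\<close> are real and odd ones imaginary, so
    \<open>u\<close> and \<open>v * b\<close> are the real and imaginary parts.\<close>
  define u where "u = pform x - taylor2 x * b ^ 2 + 750 * elem_sym 1 x * b ^ 4"
  define v where "v = taylor1 x - taylor3 x * b ^ 2 + 750 * b ^ 4"
  have "pform (\<lambda>i. ?c (x i) + \<i> * ?c b) = Complex u (v * b)"
    unfolding pform_shift[of "\<lambda>i. ?c (x i)"] coeffs es u_def v_def
    by (simp add: complex_eq_iff power_mult_distrib eval_nat_numeral) (simp add: algebra_simps)
  moreover assume "pform (\<lambda>i. ?c (x i) + \<i> * ?c b) = 0"
  ultimately have "u = 0" "v = 0"
    using assms by (simp_all add: complex_eq_iff)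
  have "u ^ 2 + b ^ 2 * v ^ 2 = pform x ^ 2
      + (taylor1 x ^ 2 - 2 * pform x * taylor2 x) * b ^ 2
      + (taylor2 x ^ 2 + 2 * pform x * (750 * elem_sym 1 x) - 2 * taylor1 x * taylor3 x) * (b ^ 2) ^ 2
      + (taylor3 x ^ 2 - 2 * taylor2 x * (750 * elem_sym 1 x) + 2 * taylor1 x * 750) * (b ^ 3) ^ 2
      + ((750 * elem_sym 1 x) ^ 2 - 2 * taylor3 x * 750) * (b ^ 4) ^ 2 + 750 ^ 2 * (b ^ 5) ^ 2"
    unfolding u_def v_def by algebra
  also have "\<dots> > 0"
    using assms
    by (intro add_nonneg_pos add_nonneg_nonneg[OF add_nonneg_nonneg[OF add_nonneg_nonneg[OF
        add_nonneg_nonneg]]] mult_nonneg_nonneg laguerre1_nonneg laguerre2_nonneg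
        laguerre3_nonneg laguerre4_nonneg) simp_all
  finally show False
    using \<open>u = 0\<close> \<open>v = 0\<close> by simp
qed

end

text \<open>By \<open>pform_shift\<close> both sides agree at every point, and over a field of
  characteristic 0 this makes the polynomials equal.\<close>

lemma pform_linear_poly:
  "pform (\<lambda>i. [:x i, 1:]) = [:pform x, taylor1 x, taylor2 x, taylor3 x, 750 * elem_sym 1 x, 750:]"
  for x :: "5 \<Rightarrow> 'a::field_char_0"
proof -
  have "poly (elem_sym k (\<lambda>i. [:x i, 1:])) t = elem_sym k (\<lambda>i. x i + t)" for k t
    by (simp add: elem_sym_def poly_sum poly_prod)
  then have "poly (pform (\<lambda>i. [:x i, 1:])) t = pform (\<lambda>i. x i + t)" for t
    by (simp add: pform_def)
  moreover have "pform (\<lambda>i. x i + t) =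
      poly [:pform x, taylor1 x, taylor2 x, taylor3 x, 750 * elem_sym 1 x, 750:] t" for t
    by (subst pform_shift) (simp add: eval_nat_numeral algebra_simps)
  ultimately have "poly (pform (\<lambda>i. [:x i, 1:])) =
      poly [:pform x, taylor1 x, taylor2 x, taylor3 x, 750 * elem_sym 1 x, 750:]"
    by (intro ext) metis
  then show ?thesis
    by (simp add: poly_eq_poly_eq_iff)
qed

lemma hyperbolic_pform: "hyperbolic 1 (pform Var)"
  unfolding hyperbolic_def
proof (intro conjI allI)
  show "homogeneous (pform Var)"
    by (rule homogeneous_pform)
  show "eval (pform Var) 1 \<noteq> 0"
    unfolding eval_pform by (simp add: pform_def elem_sym_5)
next
  fix x :: "real ^ 5"
  let ?c = "complex_of_real"
  let ?P = "pform (\<lambda>i. [:x $ i, 1:])"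
  have root: "z \<in> \<real>" if "poly (map_poly ?c ?P) z = 0" for z
  proof (rule ccontr)
    assume "z \<notin> \<real>"
    then have "Im z \<noteq> 0"
      by (simp add: complex_is_Real_iff)
    have es: "elem_sym k (\<lambda>i. ?c (x $ i)) = ?c (elem_sym k (\<lambda>i. x $ i))" for k
      by (simp add: elem_sym_def)
    have "poly (map_poly ?c ?P) z = pform (\<lambda>i. ?c (x $ i) + z)"
      unfolding pform_linear_poly pform_shift
      by (simp add: pform_def taylor1_def taylor2_def taylor3_def es map_poly_pCons
          eval_nat_numeral algebra_simps)
    \<comment> \<open>The real part of \<open>z\<close> is absorbed into the real point
      \<open>x\<close>, which leaves a purely imaginary shift.\<close>
    also have "(\<lambda>i. ?c (x $ i) + z) = (\<lambda>i. ?c (x $ i + Re z) + \<i> * ?c (Im z))"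
      by (simp add: fun_eq_iff complex_eq_iff)
    finally show False
      using that pform_imaginary_shift_nonzero[OF \<open>Im z \<noteq> 0\<close>] by metis
  qed
  have "subst (\<lambda>c. [:c:]) (\<lambda>i. [:x $ i, 1 $ i:]) (pform Var) = ?P"
    by (simp add: poly_hom.subst_pform)
  then show "real_rooted (subst (\<lambda>c. [:c:]) (\<lambda>i. [:x $ i, 1 $ i:]) (pform Var))"
    using root by (simp add: real_rooted_def)
qed

section \<open>The associated operator is not extendable\<close>

lemma map_poly_of_real_mult:
  "map_poly complex_of_real (p * q) = map_poly complex_of_real p * map_poly complex_of_real q"
  by (rule poly_eqI) (simp add: coeff_map_poly coeff_mult)

lemma poly_map_poly_of_real:
  "poly (map_poly complex_of_real p) (complex_of_real a) = complex_of_real (poly p a)"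
  by (induction p) (simp_all add: map_poly_pCons)

lemma real_rooted_cofactor:
  assumes "real_rooted (p * q)" "p * q \<noteq> 0"
  shows "real_rooted q"
  using assms unfolding real_rooted_def map_poly_of_real_mult by auto

text \<open>The fundamental theorem of algebra supplies a complex root; it is real, so a real linear
  factor splits off and the cofactor is again real-rooted.\<close>

lemma real_rooted_factorization:
  assumes "real_rooted p" "p \<noteq> 0"
  shows "\<exists>as. p = smult (lead_coeff p) (\<Prod>a\<leftarrow>as. [:- a, 1:]) \<and> length as = degree p"
  using assms
proof (induction "degree p" arbitrary: p)
  case 0
  then obtain c where "p = [:c:]"
    by (metis degree_eq_zeroE)
  then show ?case
    by (intro exI[of _ "[]"]) simp
next
  case (Suc n)
  let ?P = "map_poly complex_of_real p"
  have "degree ?P = degree p"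
    by (rule degree_map_poly) simp
  then obtain z where z: "poly ?P z = 0"
    using Suc.hyps(2) fundamental_theorem_of_algebra[of ?P] constant_degree[of ?P] by auto
  then have "z \<in> \<real>"
    using Suc.prems by (auto simp: real_rooted_def)
  then obtain a where "z = of_real a"
    by (auto elim: Reals_cases)
  with z have "poly p a = 0"
    by (simp add: poly_map_poly_of_real)
  then obtain q where q: "p = [:- a, 1:] * q"
    by (auto simp: poly_eq_0_iff_dvd elim: dvdE)
  with Suc.prems have "q \<noteq> 0" "real_rooted q"
    using real_rooted_cofactor[of "[:- a, 1:]" q] by auto
  moreover have "degree p = Suc (degree q)"
    using \<open>q \<noteq> 0\<close> unfolding q by (subst degree_mult_eq) auto
  ultimately obtain as where as: "q = smult (lead_coeff q) (\<Prod>a\<leftarrow>as. [:- a, 1:])"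
    "length as = degree q"
    using Suc.hyps(1)[of q] Suc.hyps(2) by auto
  have "lead_coeff p = lead_coeff q"
    unfolding q by (simp only: lead_coeff_mult) simp
  moreover have "p = [:- a, 1:] * smult (lead_coeff q) (\<Prod>a\<leftarrow>as. [:- a, 1:])"
    unfolding q by (rule arg_cong[OF as(1)])
  ultimately have "p = smult (lead_coeff p) (\<Prod>a\<leftarrow>a # as. [:- a, 1:])"
    by (simp only: mult_smult_right list.map prod_list.Cons)
  with as(2) \<open>degree p = Suc (degree q)\<close> show ?case
    by (intro exI[of _ "a # as"]) simp
qed

lemma sum_list_squared_le:
  fixes f :: "'a \<Rightarrow> real"
  shows "(\<Sum>a\<leftarrow>as. f a) ^ 2 \<le> real (length as) * (\<Sum>a\<leftarrow>as. f a ^ 2)"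
proof -
  have "(\<Sum>i<length as. f (as ! i)) ^ 2 \<le> real (length as) * (\<Sum>i<length as. f (as ! i) ^ 2)"
    using Cauchy_Schwarz_ineq_sum[of "\<lambda>i. 1" "\<lambda>i. f (as ! i)" "{..<length as}"] by simp
  then show ?thesis
    by (simp add: sum_list_sum_nth atLeast0LessThan)
qed

text \<open>These are the logarithmic derivative of a product of linear factors and the formula for
  the second derivative that follows from it.\<close>

lemma poly_pderiv_prod_linear:
  fixes x :: real
  assumes "\<And>a. a \<in> set as \<Longrightarrow> x \<noteq> a"
  defines "q \<equiv> \<Prod>a\<leftarrow>as. [:- a, 1:]"
  shows "poly (pderiv q) x = poly q x * (\<Sum>a\<leftarrow>as. 1 / (x - a)) \<and>
    poly (pderiv (pderiv q)) x =
      poly q x * ((\<Sum>a\<leftarrow>as. 1 / (x - a)) ^ 2 - (\<Sum>a\<leftarrow>as. (1 / (x - a)) ^ 2))"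
  using assms(1) unfolding q_def
proof (induction as)
  case (Cons a as)
  define Q where "Q = (\<Prod>a\<leftarrow>as. [:- a, 1:])"
  define h where "h = 1 / (x - a)"
  define s where "s = (\<Sum>a\<leftarrow>as. 1 / (x - a))"
  define r where "r = (\<Sum>a\<leftarrow>as. (1 / (x - a)) ^ 2)"
  have h: "(x - a) * h = 1"
    using Cons.prems by (simp add: h_def)
  have IH: "poly (pderiv Q) x = poly Q x * s" "poly (pderiv (pderiv Q)) x = poly Q x * (s ^ 2 - r)"
    using Cons by (simp_all add: Q_def s_def r_def)
  have [simp]: "pderiv [:- a, 1:] = 1"
    by (simp add: pderiv_pCons)
  have d1: "pderiv ([:- a, 1:] * Q) = Q + [:- a, 1:] * pderiv Q"
    by (subst pderiv_mult) (simp add: mult.commute)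
  have d2: "pderiv (Q + [:- a, 1:] * pderiv Q) = 2 * pderiv Q + [:- a, 1:] * pderiv (pderiv Q)"
    by (subst pderiv_add, subst pderiv_mult) (simp add: mult.commute)
  have "poly Q x + (x - a) * (poly Q x * s) = (x - a) * poly Q x * (h + s)"
    "2 * (poly Q x * s) + (x - a) * (poly Q x * (s ^ 2 - r)) =
      (x - a) * poly Q x * ((h + s) ^ 2 - (h ^ 2 + r))"
    using h by algebra+
  moreover have "poly [:- a, 1:] x = x - a"
    by simp
  moreover have "poly (2 :: real poly) x = 2"
    by simp
  ultimately show ?case
    unfolding list.map prod_list.Cons sum_list.Cons Q_def[symmetric] s_def[symmetric]
      r_def[symmetric] h_def[symmetric] d1 d2 poly_add poly_mult IH
    by simp
qed (simp add: pderiv_1)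

text \<open>Where \<open>p\<close> does not vanish, the difference of the two sides is
  \<open>(c * poly q x) ^ 2 * (n * r - s ^ 2)\<close>, nonnegative by Cauchy-Schwarz. Where it
  vanishes, the left side is 0.\<close>

lemma real_rooted_laguerre:
  assumes "real_rooted p" "degree p \<le> n" "n \<ge> 1"
  shows "real n * (poly p x * poly (pderiv (pderiv p)) x) \<le> (real n - 1) * poly (pderiv p) x ^ 2"
proof (cases "poly p x = 0")
  case False
  then have "p \<noteq> 0" by auto
  then obtain as where as: "p = smult (lead_coeff p) (\<Prod>a\<leftarrow>as. [:- a, 1:])" "length as = degree p"
    using real_rooted_factorization[OF assms(1)] by blast
  define c where "c = lead_coeff p"
  define q where "q = (\<Prod>a\<leftarrow>as. [:- a, 1:])"
  define s where "s = (\<Sum>a\<leftarrow>as. 1 / (x - a))"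
  define r where "r = (\<Sum>a\<leftarrow>as. (1 / (x - a)) ^ 2)"
  have p: "p = smult c q"
    unfolding c_def q_def by (rule as(1))
  have "poly (\<Prod>a\<leftarrow>bs. [:- a, 1:]) a = 0" if "a \<in> set bs" for a and bs :: "real list"
    using that by (induction bs) auto
  then have "x \<noteq> a" if "a \<in> set as" for a
    using False that unfolding p q_def by auto
  then have d: "poly (pderiv q) x = poly q x * s" "poly (pderiv (pderiv q)) x = poly q x * (s ^ 2 - r)"
    using poly_pderiv_prod_linear[of as x] by (auto simp: q_def s_def r_def)
  have "r \<ge> 0"
    unfolding r_def by (rule sum_list_map_nonneg) simp
  have "s ^ 2 \<le> real (length as) * r"
    unfolding s_def r_def by (rule sum_list_squared_le)
  also have "\<dots> \<le> real n * r"
    using assms(2) \<open>r \<ge> 0\<close> by (intro mult_right_mono) (simp_all add: as(2))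
  finally have "0 \<le> (c * poly q x) ^ 2 * (real n * r - s ^ 2)"
    by simp
  then show ?thesis
    unfolding p pderiv_smult poly_smult d by (simp add: algebra_simps power2_eq_square)
qed (use assms in simp)

text \<open>For a monic \<open>g\<close> of degree 5 with roots \<open>r\<close> summing to 0, the
  values of \<open>e1, e3, e4, e5\<close> at \<open>r - t 1\<close> are \<open>- 5 t\<close>,
  \<open>- g'' / 2\<close>, \<open>g'\<close> and \<open>- g\<close>. Hence the operator is
  \<open>- 4500 g + 1100 t g' - 175 / 2 t^2 g''\<close>, which multiplies \<open>t ^ j\<close> by
  this weight.\<close>

definition weight :: "nat \<Rightarrow> real" where
  "weight j = - 4500 + 1100 * real j - 175 / 2 * real j * (real j - 1)"

definition diag_op :: "real poly \<Rightarrow> real poly" where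
  "diag_op g = (\<Sum>j\<le>5. monom (weight j * coeff g j) j)"

lemma coeff_diag_op: "coeff (diag_op g) k = (if k \<le> 5 then weight k * coeff g k else 0)"
  by (simp add: diag_op_def coeff_sum)

lemma prod_linear_5:
  "(\<Prod>i\<in>UNIV. [:- r i, 1:]) = [:- elem_sym 5 r, elem_sym 4 r, - elem_sym 3 r, elem_sym 2 r,
    - elem_sym 1 r, 1:]" for r :: "5 \<Rightarrow> 'a::field_char_0"
proof -
  have "poly (\<Prod>i\<in>UNIV. [:- r i, 1:]) t = (t - r 0) * (t - r 1) * (t - r 2) * (t - r 3) * (t - r 4)"
    for t
    unfolding poly_prod unfolding prod_UNIV_5 by simp
  also have "\<dots> t = poly [:- elem_sym 5 r, elem_sym 4 r, - elem_sym 3 r,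
      elem_sym 2 r, - elem_sym 1 r, 1:] t" for t
    unfolding elem_sym_5 One_nat_def poly_pCons poly_0 by algebra
  finally show ?thesis
    by (simp add: poly_eq_poly_eq_iff[symmetric] fun_eq_iff)
qed

lemma diag_op_root_formula:
  fixes r :: "complex ^ 5"
  assumes g: "g \<in> polys0 5"
    and factored: "map_poly complex_of_real g = smult (complex_of_real a) (\<Prod>i\<in>UNIV. [:- (r $ i), 1:])"
    and "a \<noteq> 0"
  shows "map_poly complex_of_real (diag_op g) = smult (complex_of_real a)
    (subst (\<lambda>c. [:complex_of_real c:]) (\<lambda>i. [:r $ i, -1:]) (pform Var))"
proof -
  let ?c = complex_of_real and ?r = "\<lambda>i. r $ i"
  have coeffs: "?c (coeff g k) = ?c a * coeff [:- elem_sym 5 ?r, elem_sym 4 ?r, - elem_sym 3 ?r,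
      elem_sym 2 ?r, - elem_sym 1 ?r, 1:] k" for k
    using arg_cong[OF factored, of "\<lambda>p. coeff p k"]
    unfolding prod_linear_5[of ?r] by (simp add: coeff_map_poly del: smult_pCons)
  \<comment> \<open>The missing coefficient of \<open>t ^ 4\<close> says that the roots sum to 0;
    all terms containing \<open>e1\<close> then drop out.\<close>
  have "coeff g 4 = 0"
    using g by (simp add: polys0_def)
  with coeffs[of 4] \<open>a \<noteq> 0\<close> have e1: "elem_sym 1 ?r = 0"
    by (simp add: numeral_eq_Suc)
  have "poly (map_poly ?c (diag_op g)) t =
      ?c a * poly (pform (\<lambda>i. [:r $ i, -1:])) t" for t
  proof -
    have "poly (map_poly ?c (diag_op g)) t = (\<Sum>k\<le>5. ?c (weight k) * ?c (coeff g k) * t ^ k)"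
    proof -
      have "map_poly ?c (diag_op g) = (\<Sum>k\<le>5. monom (?c (weight k) * ?c (coeff g k)) k)"
        by (rule poly_eqI) (simp add: coeff_map_poly coeff_diag_op coeff_sum)
      then show ?thesis
        by (simp add: poly_sum poly_monom)
    qed
    also have "\<dots> = ?c a * (4500 * elem_sym 5 ?r - 3400 * elem_sym 4 ?r * t
        + 2475 * elem_sym 3 ?r * t ^ 2 - 1725 * elem_sym 2 ?r * t ^ 3 - 750 * t ^ 5)"
      unfolding coeffs weight_def e1
      by (simp add: numeral_eq_Suc atMost_Suc) (simp add: algebra_simps)
    also have "4500 * elem_sym 5 ?r - 3400 * elem_sym 4 ?r * t
        + 2475 * elem_sym 3 ?r * t ^ 2 - 1725 * elem_sym 2 ?r * t ^ 3 - 750 * t ^ 5 =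
        pform (\<lambda>i. r $ i + (- t))"
      unfolding pform_shift[of ?r] pform_def taylor1_def taylor2_def taylor3_def e1
      by (simp add: eval_nat_numeral)
    also have "\<dots> = poly (pform (\<lambda>i. [:r $ i, -1:])) t"
      by (simp add: pform_def elem_sym_def poly_sum poly_prod)
    finally show ?thesis .
  qed
  then show ?thesis
    by (simp add: cpoly_hom.subst_pform poly_eq_poly_eq_iff[symmetric] fun_eq_iff)
qed

lemma is_associated_operator_diag_op: "is_associated_operator 5 (pform Var) diag_op"
  unfolding is_associated_operator_def
proof (intro conjI)
  have "degree (diag_op g) \<le> 5" for g
    by (rule degree_le) (simp add: coeff_diag_op)
  then show "diag_op \<in> polys0 CARD(5) \<rightarrow> polys0 5"
    by (auto simp: polys0_def polys_def coeff_diag_op)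
  show "\<forall>G. \<forall>g\<in>polys0 CARD(5). (\<forall>k. G k \<in> polys0 CARD(5)) \<longrightarrow>
      (\<forall>j. (\<lambda>k. coeff (G k) j) \<longlonglongrightarrow> coeff g j) \<longrightarrow>
      (\<forall>j. (\<lambda>k. coeff (diag_op (G k)) j) \<longlonglongrightarrow> coeff (diag_op g) j)"
    by (auto simp: coeff_diag_op intro!: tendsto_intros)
qed (use diag_op_root_formula in auto)

text \<open>The root formula alone determines \<open>T\<close> here. A single such \<open>g\<close>
  suffices below to read off the multipliers of any extension.\<close>

lemma associated_operator_eq_diag_op:
  fixes r :: "real ^ 5"
  assumes T: "is_associated_operator 5 (pform Var) T"
    and g: "g = (\<Prod>i\<in>UNIV. [:- (r $ i), 1:])" "g \<in> polys0 5"
  shows "T g = diag_op g"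
proof -
  let ?r = "\<chi> i. complex_of_real (r $ i)"
  have "map_poly complex_of_real (\<Prod>i\<in>A. [:- (r $ i), 1:]) = (\<Prod>i\<in>A. [:- (?r $ i), 1:])"
    if "finite A" for A
    using that
  proof induction
    case (insert i A)
    have "map_poly complex_of_real [:- (r $ i), 1:] = [:- (?r $ i), 1:]"
      by (simp add: map_poly_pCons)
    then show ?case
      unfolding prod.insert[OF insert.hyps] map_poly_of_real_mult insert.IH by simp
  qed simp
  then have "map_poly complex_of_real g = smult (complex_of_real 1) (\<Prod>i\<in>UNIV. [:- (?r $ i), 1:])"
    by (simp add: g(1))
  moreover from this have "map_poly complex_of_real (diag_op g) = smult (complex_of_real 1)
      (subst (\<lambda>c. [:complex_of_real c:]) (\<lambda>i. [:?r $ i, -1:]) (pform Var))"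
    by (rule diag_op_root_formula[OF g(2)]) simp
  moreover have "g \<in> polys0 CARD(5)"
    using g(2) by simp
  ultimately have "map_poly complex_of_real (T g) = map_poly complex_of_real (diag_op g)"
    using T unfolding is_associated_operator_def by (metis zero_neq_one)
  then show ?thesis
    by (metis (no_types, lifting) coeff_map_poly of_real_0 of_real_eq_iff poly_eqI)
qed


lemma real_rooted_linear_power: "real_rooted ([:0, 1:] ^ j * [:1, 1:] ^ k)"
proof -
  have "map_poly complex_of_real (p ^ n) = map_poly complex_of_real p ^ n" for p n
    by (induction n) (simp_all add: map_poly_of_real_mult)
  then have "poly (map_poly complex_of_real ([:0, 1:] ^ j * [:1, 1:] ^ k)) z = z ^ j * (1 + z) ^ k" for z
    by (simp add: map_poly_of_real_mult map_poly_pCons)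
  moreover have "z \<in> \<real>" if "z ^ j * (1 + z) ^ k = 0" for z :: complex
  proof -
    have "z = 0 \<or> z = - 1"
      using that by (auto simp: add_eq_0_iff)
    then show ?thesis by auto
  qed
  ultimately show ?thesis
    by (auto simp: real_rooted_def)
qed

lemma not_extendable:
  assumes T: "is_associated_operator 5 (pform Var) T"
  shows "\<not> extendable 5 5 T"
proof
  assume "extendable 5 5 T"
  then obtain T' where T': "T' \<in> polys 5 \<rightarrow> polys 5 \<and>
      (\<forall>g \<in> polys 5. \<forall>h \<in> polys 5. T' (g + h) = T' g + T' h) \<and>
      (\<forall>c. \<forall>g \<in> polys 5. T' (smult c g) = smult c (T' g)) \<and>
      (\<exists>\<gamma>. \<forall>k\<le>5. T' (monom 1 (5 - k)) = (if k \<le> 5 then monom (\<gamma> k) (5 - k) else 0)) \<and>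
      (\<forall>g \<in> polys 5. real_rooted g \<longrightarrow> real_rooted (T' g)) \<and>
      (\<forall>g \<in> polys0 5. T' g = T g)"
    unfolding extendable_def by (rule exE)
  note ext_add = T'[THEN conjunct2, THEN conjunct1]
    and ext_scale = T'[THEN conjunct2, THEN conjunct2, THEN conjunct1]
    and ext_rooted = T'[THEN conjunct2, THEN conjunct2, THEN conjunct2, THEN conjunct2, THEN conjunct1]
    and ext_T = T'[THEN conjunct2, THEN conjunct2, THEN conjunct2, THEN conjunct2, THEN conjunct2]
  from T'[THEN conjunct2, THEN conjunct2, THEN conjunct2, THEN conjunct1]
  obtain \<gamma> where
    ext_diag: "\<forall>k\<le>5. T' (monom 1 (5 - k)) = (if k \<le> 5 then monom (\<gamma> k) (5 - k) else 0)"
    by (rule exE)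
  have mon: "T' (monom c j) = monom (\<gamma> (5 - j) * c) j" if "j \<le> 5" for c j
  proof -
    have "monom c j = smult c (monom 1 j)" and "monom 1 j \<in> polys 5"
      using that by (auto simp: smult_monom polys_def degree_monom_eq)
    then show ?thesis
      using ext_diag[rule_format, of "5 - j"] ext_scale[rule_format, of "monom 1 j" c] that
      by (simp add: smult_monom mult.commute)
  qed
  have "T' (\<Sum>j\<in>A. monom (c j) j) = (\<Sum>j\<in>A. monom (\<gamma> (5 - j) * c j) j)" if "A \<subseteq> {..5}" for c A
  proof -
    have "finite A" using that finite_subset by auto
    then show ?thesis using that
    proof induction
      case empty
      then show ?case using mon[of 0 0] by simp
    next
      case (insert j A)
      have mem: "monom (c j) j \<in> polys 5" if "j \<le> 5" for j
        using that degree_monom_le[of "c j" j] by (simp add: polys_def)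
      have "(\<Sum>j\<in>A. monom (c j) j) \<in> polys 5"
        unfolding polys_def mem_Collect_eq
      proof (rule degree_sum_le[OF insert.hyps(1)])
        show "degree (monom (c j) j) \<le> 5" if "j \<in> A" for j
          using mem[of j] that insert.prems by (auto simp: polys_def)
      qed
      then have "T' (\<Sum>j\<in>insert j A. monom (c j) j) = T' (monom (c j) j) + T' (\<Sum>j\<in>A. monom (c j) j)"
        using ext_add mem[of j] insert.hyps insert.prems by simp
      then show ?case
        using insert mon[of j "c j"] by simp
    qed
  qed
  from this[of "{..5}"] have T'_sum:
    "T' (\<Sum>j\<le>5. monom (c j) j) = (\<Sum>j\<le>5. monom (\<gamma> (5 - j) * c j) j)" for c
    by simp
  define p5 where "p5 = (\<lambda>c0 c1 c2 c3 c4 c5 :: real. [:c0, c1, c2, c3, c4, c5:])"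
  have p5_sum: "p5 (c 0) (c 1) (c 2) (c 3) (c 4) (c 5) = (\<Sum>j\<le>5. monom (c j) j)" for c
    unfolding p5_def by (simp add: numeral_eq_Suc monom_Suc monom_0 atMost_Suc)
  have T'_p5: "T' (p5 c0 c1 c2 c3 c4 c5) =
      p5 (\<gamma> 5 * c0) (\<gamma> 4 * c1) (\<gamma> 3 * c2) (\<gamma> 2 * c3) (\<gamma> 1 * c4) (\<gamma> 0 * c5)" for c0 c1 c2 c3 c4 c5
  proof -
    define c where "c = (\<lambda>j::nat. [c0, c1, c2, c3, c4, c5] ! j)"
    have "T' (p5 (c 0) (c 1) (c 2) (c 3) (c 4) (c 5)) =
        p5 (\<gamma> (5 - 0) * c 0) (\<gamma> (5 - 1) * c 1) (\<gamma> (5 - 2) * c 2) (\<gamma> (5 - 3) * c 3)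
          (\<gamma> (5 - 4) * c 4) (\<gamma> (5 - 5) * c 5)"
      unfolding p5_sum[of c] T'_sum p5_sum[of "\<lambda>j. \<gamma> (5 - j) * c j", symmetric] ..
    then show ?thesis
      by (simp add: c_def numeral_eq_Suc)
  qed
  \<comment> \<open>This is \<open>(t - 1)^3 (t + 1) (t + 2)\<close>: its roots sum to 0, and every
    coefficient other than that of \<open>t ^ 4\<close> is nonzero, so the image reveals all
    multipliers but \<open>\<gamma> 1\<close>.\<close>
  define g where "g = p5 (-2) 3 2 (-4) 0 1"
  define r :: "real ^ 5" where
    "r = (\<chi> i. if i = 0 \<or> i = 1 \<or> i = 3 then 1 else if i = 2 then - 2 else - 1)"
  have g: "g = (\<Prod>i\<in>UNIV. [:- (r $ i), 1:])"
    unfolding g_def p5_def r_def prod_UNIV_5 by simp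
  have "g \<in> polys0 5"
    by (simp add: g_def p5_def polys0_def polys_def numeral_eq_Suc)
  then have "T' g = diag_op g"
    using associated_operator_eq_diag_op[OF T g] ext_T by simp
  moreover have "diag_op g = p5 9000 (- 10200) (- 4950) 6900 0 (- 750)"
    unfolding diag_op_def g_def p5_def by (simp add: weight_def numeral_eq_Suc monom_Suc monom_0 atMost_Suc)
  ultimately have \<gamma>: "\<gamma> 0 = - 750" "\<gamma> 2 = - 1725" "\<gamma> 3 = - 2475" "\<gamma> 4 = - 3400" "\<gamma> 5 = - 4500"
    unfolding g_def T'_p5 by (simp_all add: p5_def)
  text \<open>Only \<open>\<gamma> 1\<close> is free; the Laguerre inequalities for the images of \<open>(t + 1)\<^sup>4\<close>, \<open>t (t + 1)\<^sup>3\<close>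
    and \<open>t\<^sup>2 (t + 1)\<^sup>3\<close> leave no value for it.\<close>
  have image: "real_rooted (T' (p5 c0 c1 c2 c3 c4 c5))"
    if "p5 c0 c1 c2 c3 c4 c5 = [:0, 1:] ^ j * [:1, 1:] ^ k" for c0 c1 c2 c3 c4 c5 j k
  proof (rule ext_rooted[rule_format])
    show "p5 c0 c1 c2 c3 c4 c5 \<in> polys 5"
      by (simp add: polys_def p5_def)
    show "real_rooted (p5 c0 c1 c2 c3 c4 c5)"
      unfolding that by (rule real_rooted_linear_power)
  qed
  have "p5 1 4 6 4 1 0 = [:0, 1:] ^ 0 * [:1, 1:] ^ 4"
    by (simp add: p5_def numeral_eq_Suc)
  from image[OF this] have rooted1: "real_rooted [:- 4500, - 13600, - 14850, - 6900, \<gamma> 1:]"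
    by (simp add: T'_p5 \<gamma>) (simp add: p5_def)
  have degree1: "degree [:- 4500, - 13600, - 14850, - 6900, \<gamma> 1:] \<le> 4"
    by (rule degree_le) (simp add: coeff_pCons split: nat.split)
  \<comment> \<open>At -1 the value is \<open>\<gamma> 1 + 1150\<close> and the derivative is -4
    times that, so the quadratic terms cancel and a linear bound remains.\<close>
  from real_rooted_laguerre[OF rooted1 degree1, of "-1"] have "\<gamma> 1 \<ge> - 1150"
    by (simp add: pderiv_pCons power2_eq_square algebra_simps)
  have "p5 0 1 3 3 1 0 = [:0, 1:] ^ 1 * [:1, 1:] ^ 3"
    by (simp add: p5_def numeral_eq_Suc)
  from image[OF this] have "real_rooted ([:0, 1:] * [:- 3400, - 7425, - 5175, \<gamma> 1:])"
    by (simp add: T'_p5 \<gamma>) (simp add: p5_def)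
  then have rooted2: "real_rooted [:- 3400, - 7425, - 5175, \<gamma> 1:]"
    by (rule real_rooted_cofactor) simp
  have degree2: "degree [:- 3400, - 7425, - 5175, \<gamma> 1:] \<le> 3"
    by (rule degree_le) (simp add: coeff_pCons split: nat.split)
  \<comment> \<open>The quadratic terms in \<open>\<gamma> 1\<close> cancel again; the bound
    obtained is slightly stronger than -1100.\<close>
  from real_rooted_laguerre[OF rooted2 degree2, of "-1"] have "\<gamma> 1 \<le> - 1100"
    by (simp add: pderiv_pCons power2_eq_square algebra_simps)
  have "p5 0 0 1 3 3 1 = [:0, 1:] ^ 2 * [:1, 1:] ^ 3"
    by (simp add: p5_def numeral_eq_Suc)
  from image[OF this] have "real_rooted ([:0, 0, 1:] * [:- 2475, - 5175, 3 * \<gamma> 1, - 750:])"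
    by (simp add: T'_p5 \<gamma>) (simp add: p5_def mult.commute)
  then have rooted3: "real_rooted [:- 2475, - 5175, 3 * \<gamma> 1, - 750:]"
    by (rule real_rooted_cofactor) simp
  have degree3: "degree [:- 2475, - 5175, 3 * \<gamma> 1, - 750:] \<le> 3"
    by (rule degree_le) (simp add: coeff_pCons split: nat.split)
  from real_rooted_laguerre[OF rooted3 degree3, of "-2"] have "0 \<le> 8 * \<gamma> 1 ^ 2 + 11850 * \<gamma> 1 + 3026250"
    by (simp add: pderiv_pCons power2_eq_square algebra_simps)
  \<comment> \<open>Between the two bounds the square of \<open>\<gamma> 1\<close> lies below its
    chord, which turns the third inequality into a contradictory linear one.\<close>
  moreover have "(\<gamma> 1 + 1150) * (\<gamma> 1 + 1100) \<le> 0"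
    using \<open>\<gamma> 1 \<ge> - 1150\<close> \<open>\<gamma> 1 \<le> - 1100\<close> by (intro mult_nonneg_nonpos) simp_all
  ultimately show False
    using \<open>\<gamma> 1 \<ge> - 1150\<close> \<open>\<gamma> 1 \<le> - 1100\<close> by (simp add: power2_eq_square algebra_simps)
qed

section \<open>A Rayleigh difference that is not a sum of squares\<close>

lemma poly_bounded_imp_degree_0:
  fixes p :: "real poly"
  assumes "\<And>s. poly p s ^ 2 \<le> K"
  shows "degree p = 0"
proof (rule ccontr)
  assume "degree p \<noteq> 0"
  then have "p \<noteq> 0" by auto
  obtain c q where q: "p ^ 2 = pCons c q"
    by (cases "p ^ 2")
  have "degree (p ^ 2) \<noteq> 0"
    using \<open>degree p \<noteq> 0\<close> \<open>p \<noteq> 0\<close> by (simp add: degree_power_eq)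
  then have "q \<noteq> 0"
    unfolding q by auto
  then have "lead_coeff q = lead_coeff (p ^ 2)"
    unfolding q by simp
  also have "\<dots> > 0"
    using \<open>p \<noteq> 0\<close> by (simp add: lead_coeff_power)
  finally have pos: "lead_coeff q > 0" .
  then obtain n where n: "\<And>x. x \<ge> n \<Longrightarrow> poly q x \<ge> lead_coeff q"
    using poly_pinfty_gt_lc by blast
  define x where "x = max 0 (max n ((K - c + 1) / lead_coeff q))"
  have "K - c + 1 \<le> x * lead_coeff q"
    using pos by (simp add: x_def pos_divide_le_eq[symmetric] del: max.bounded_iff)
  also have "\<dots> \<le> x * poly q x"
    by (intro mult_left_mono n) (simp_all add: x_def)
  also have "c + x * poly q x = poly p x ^ 2"
    using arg_cong[OF q, of "\<lambda>r. poly r x"] by simp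
  then have "x * poly q x \<le> K - c"
    using assms[of x] by simp
  finally show False by simp
qed

lemma square_le_at_0:
  fixes g k :: "real \<Rightarrow> real"
  assumes "isCont g 0" "isCont k 0" "\<And>h. h \<noteq> 0 \<Longrightarrow> \<bar>h\<bar> < 1 \<Longrightarrow> g h ^ 2 \<le> k h"
  shows "g 0 ^ 2 \<le> k 0"
proof (rule tendsto_le[of "at (0 :: real)"])
  show "(k \<longlongrightarrow> k 0) (at 0)" "((\<lambda>h. g h ^ 2) \<longlongrightarrow> g 0 ^ 2) (at 0)"
    using assms(1,2) by (auto simp: isCont_def intro: tendsto_power)
  show "\<forall>\<^sub>F h in at 0. g h ^ 2 \<le> k h"
    using assms(3) by (auto simp: eventually_at intro!: exI[of _ 1])
qed simp

text \<open>The bound forces a root at 0. Dividing by \<open>s\<close> lowers \<open>m\<close> by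
  one, and continuity restores the bound at 0; at \<open>m = 0\<close> a bounded polynomial is
  constant.\<close>

lemma poly_eq_monom_of_bound:
  fixes p :: "real poly"
  assumes "\<And>s. poly p s ^ 2 \<le> K * (s ^ m) ^ 2"
  shows "p = monom (coeff p m) m"
  using assms
proof (induction m arbitrary: p)
  case 0
  then have "degree p = 0"
    by (intro poly_bounded_imp_degree_0[of p K]) simp
  then show ?case
    by (metis degree_eq_zeroE coeff_pCons_0 monom_0)
next
  case (Suc m)
  obtain c q where p: "p = pCons c q"
    by (cases p)
  have "c = 0"
    using Suc.prems[of 0] by (simp add: p)
  have bound: "poly q s ^ 2 \<le> K * (s ^ m) ^ 2" if "s \<noteq> 0" for s
  proof -
    have "s ^ 2 * poly q s ^ 2 \<le> s ^ 2 * (K * (s ^ m) ^ 2)"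
      using Suc.prems[of s] by (simp add: p \<open>c = 0\<close> power_mult_distrib mult_ac)
    with that show ?thesis by simp
  qed
  have "poly q s ^ 2 \<le> K * (s ^ m) ^ 2" for s
  proof (cases "s = 0")
    case True
    have "poly q 0 ^ 2 \<le> K * (0 ^ m) ^ 2"
      by (rule square_le_at_0[of "poly q" "\<lambda>s. K * (s ^ m) ^ 2"])
        (use bound in \<open>auto intro!: continuous_intros\<close>)
    with True show ?thesis by simp
  qed (rule bound)
  from Suc.IH[OF this] show ?case
    by (metis \<open>c = 0\<close> coeff_pCons_Suc monom_Suc p)
qed

section \<open>The Rayleigh difference on the face where the first coordinate is 0\<close>

definition face :: "real \<Rightarrow> real \<Rightarrow> real \<Rightarrow> real \<Rightarrow> real ^ 5" where
  "face a b c d = (\<chi> i. if i = 1 then a else if i = 2 then b else if i = 3 then c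
    else if i = 4 then d else 0)"

lemma face_nth [simp]:
  "face a b c d $ 0 = 0" "face a b c d $ 1 = a" "face a b c d $ 2 = b" "face a b c d $ 3 = c"
  "face a b c d $ 4 = d"
  by (simp_all add: face_def)

text \<open>Along each line through the origin the square of \<open>q\<close> is at most a multiple
  of \<open>s ^ 8\<close>, so only the part of degree 4 survives on the face. \<open>C i j k\<close>
  collects its coefficients by the exponents of \<open>a, b, c\<close>; that of \<open>d\<close> is
  then determined.\<close>

lemma eval_quartic_on_face:
  fixes q :: "5 mpoly"
  assumes bound: "\<And>a b c d. eval q (face a b c d) ^ 2 \<le> F a b c d"
    and homog: "\<And>s a b c d. F (s * a) (s * b) (s * c) (s * d) = (s ^ 4) ^ 2 * F a b c d"
  shows "\<exists>C :: nat \<Rightarrow> nat \<Rightarrow> nat \<Rightarrow> real. \<forall>a b c d. eval q (face a b c d) =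
      (\<Sum>i\<le>4. \<Sum>j\<le>4 - i. \<Sum>k\<le>4 - i - j. C i j k * (a ^ i * b ^ j * c ^ k * d ^ (4 - i - j - k)))"
proof -
  let ?l = "Poly_Mapping.lookup"
  define M where "M = {m \<in> Poly_Mapping.keys q. (\<Sum>i\<in>UNIV. ?l m i) = 4 \<and> ?l m 0 = 0}"
  define C where "C i j k = (\<Sum>m\<in>{m \<in> M. (?l m 1, ?l m 2, ?l m 3) = (i, j, k)}. ?l q m)" for i j k
  have "eval q (face a b c d) =
      (\<Sum>i\<le>4. \<Sum>j\<le>4 - i. \<Sum>k\<le>4 - i - j. C i j k * (a ^ i * b ^ j * c ^ k * d ^ (4 - i - j - k)))"
    for a b c d
  proof -
    let ?x = "face a b c d"
    define P where "P = (\<Sum>m\<in>Poly_Mapping.keys q.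
      monom (?l q m * (\<Prod>i\<in>UNIV. (?x $ i) ^ ?l m i)) (\<Sum>i\<in>UNIV. ?l m i))"
    have P: "poly P s = eval q (face (s * a) (s * b) (s * c) (s * d))" for s
    proof -
      have "(\<Prod>i\<in>UNIV. (face (s * a) (s * b) (s * c) (s * d) $ i) ^ n i) =
          (\<Prod>i\<in>UNIV. (?x $ i) ^ n i) * s ^ (\<Sum>i\<in>UNIV. n i)" for n
        by (cases "n 0 = 0")
          (simp_all add: prod_UNIV_5 sum_UNIV_5 power_mult_distrib power_add mult_ac)
      then show ?thesis
        by (simp add: P_def eval_def subst_def poly_sum poly_monom mult.assoc)
    qed
    have "P = monom (coeff P 4) 4"
      by (rule poly_eq_monom_of_bound[of P "F a b c d"])
        (use bound homog in \<open>simp add: P mult.commute[of "F a b c d"]\<close>, metis)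
    then have "poly P 1 = coeff P 4"
      by (metis poly_monom power_one mult.right_neutral)
    then have "eval q ?x = (\<Sum>m\<in>Poly_Mapping.keys q. if (\<Sum>i\<in>UNIV. ?l m i) = 4
        then ?l q m * (\<Prod>i\<in>UNIV. (?x $ i) ^ ?l m i) else 0)"
      using P[of 1] by (simp add: P_def coeff_sum)
    also have "\<dots> = (\<Sum>m\<in>M. ?l q m * (\<Prod>i\<in>UNIV. (?x $ i) ^ ?l m i))"
      unfolding M_def by (intro sum.mono_neutral_cong_right) (auto simp: prod_UNIV_5)
    also have "\<dots> = (\<Sum>m\<in>M. ?l q m * (a ^ ?l m 1 * b ^ ?l m 2 * c ^ ?l m 3
        * d ^ (4 - ?l m 1 - ?l m 2 - ?l m 3)))"
    proof (intro sum.cong refl)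
      fix m assume "m \<in> M"
      then have "?l m 0 = 0" "?l m 4 = 4 - ?l m 1 - ?l m 2 - ?l m 3"
        by (auto simp: M_def sum_UNIV_5)
      then show "?l q m * (\<Prod>i\<in>UNIV. (?x $ i) ^ ?l m i) = ?l q m * (a ^ ?l m 1 * b ^ ?l m 2
          * c ^ ?l m 3 * d ^ (4 - ?l m 1 - ?l m 2 - ?l m 3))"
        by (simp add: prod_UNIV_5)
    qed
    also have "\<dots> = (\<Sum>(i, j, k) \<in> (SIGMA i:{..4}. SIGMA j:{..4 - i}. {..4 - i - j}).
        \<Sum>m\<in>{m \<in> M. (?l m 1, ?l m 2, ?l m 3) = (i, j, k)}.
          ?l q m * (a ^ ?l m 1 * b ^ ?l m 2 * c ^ ?l m 3 * d ^ (4 - ?l m 1 - ?l m 2 - ?l m 3)))"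
      unfolding case_prod_beta prod.collapse
      by (rule sum.group[symmetric]) (auto simp: M_def sum_UNIV_5)
    also have "\<dots> = (\<Sum>(i, j, k) \<in> (SIGMA i:{..4}. SIGMA j:{..4 - i}. {..4 - i - j}).
        C i j k * (a ^ i * b ^ j * c ^ k * d ^ (4 - i - j - k)))"
      by (intro sum.cong refl) (auto simp: C_def sum_distrib_right)
    also have "\<dots> = (\<Sum>i\<le>4. \<Sum>j\<le>4 - i. \<Sum>k\<le>4 - i - j.
        C i j k * (a ^ i * b ^ j * c ^ k * d ^ (4 - i - j - k)))"
      by (simp add: sum.Sigma)
    finally show ?thesis .
  qed
  then show ?thesis by (intro exI[of _ C] allI)
qed

text \<open>The polynomial \<open>p\<close> vanishes to second order at this boundary point of the cone.\<close>

definition edge :: "real ^ 5" where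
  "edge = (\<chi> i. if i = 0 then 6 else 1)"

lemma edge_nth [simp]: "edge $ 0 = 6" "edge $ 1 = 1" "edge $ 2 = 1" "edge $ 3 = 1" "edge $ 4 = 1"
  by (simp_all add: edge_def)

lemma edge_in_cone: "edge \<in> hyperbolicity_cone 1 (pform Var)"
proof -
  have "eval (pform Var) (edge + t *\<^sub>R 1) = 750 * t ^ 2 * (t + 1) ^ 2 * (t + 8)" for t
    unfolding eval_pform unfolding pform_def elem_sym_5 One_nat_def by simp algebra
  then show ?thesis
    by (auto simp: hyperbolicity_cone_def add_eq_0_iff)
qed

text \<open>With \<open>f1\<close> to \<open>f4\<close> elementary symmetric in the four remaining
  variables, the squared factor is the derivative of \<open>p\<close> along \<open>edge\<close>. The
  subtracted product is \<open>p\<close> times its second derivative.\<close>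

definition delta_face :: "real \<Rightarrow> real \<Rightarrow> real \<Rightarrow> real \<Rightarrow> real" where
  "delta_face a b c d =
    (let f1 = a + b + c + d; f2 = a * b + a * c + a * d + b * c + b * d + c * d;
         f3 = a * b * c + a * b * d + a * c * d + b * c * d; f4 = a * b * c * d in
      (24800 * f4 - 1400 * f1 * f3 + 56 * f1 ^ 2 * f2) ^ 2
      - f1 * (7 * f1 * f3 - 220 * f4) * (24600 * f3 - 3480 * f1 * f2 + 294 * f1 ^ 3))"

lemma eval_Delta_edge_face:
  "eval (Delta edge edge (pform Var)) (face a b c d) = delta_face a b c d"
proof -
  note expand = pform_def elem_sym_5 One_nat_def
  have C6: "Const 6 = (6 :: 5 mpoly)"
    by (simp add: numeral_eq_Const)
  let ?ev = "\<lambda>p. eval p (face a b c d)"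
  note hom = eval_hom.subst_add eval_hom.subst_mult eval_hom.subst_diff eval_hom.subst_power
    eval_hom.subst_uminus
    eval_hom.subst_numeral eval_hom.subst_Var eval_hom.subst_0 eval_hom.subst_1
  have "?ev (pform Var) = (a + b + c + d) * (7 * (a + b + c + d) * (a * b * c + a * b * d + a * c * d + b * c * d)
      - 220 * (a * b * c * d))"
    unfolding eval_pform unfolding expand by simp algebra
  moreover have "?ev (dir_deriv edge (pform Var)) = 24800 * (a * b * c * d)
      - 1400 * (a + b + c + d) * (a * b * c + a * b * d + a * c * d + b * c * d)
      + 56 * (a + b + c + d) ^ 2 * (a * b + a * c + a * d + b * c + b * d + c * d)"
    unfolding expand by (simp add: dir_deriv_simps dir_deriv_uminus C6 eval_def hom) algebra
  moreover have "?ev (dir_deriv edge (dir_deriv edge (pform Var))) =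
      24600 * (a * b * c + a * b * d + a * c * d + b * c * d)
      - 3480 * (a + b + c + d) * (a * b + a * c + a * d + b * c + b * d + c * d)
      + 294 * (a + b + c + d) ^ 3"
    unfolding expand by (simp add: dir_deriv_simps dir_deriv_uminus C6 eval_def hom) algebra
  ultimately show ?thesis
    by (simp add: Delta_def eval_def hom delta_face_def Let_def power2_eq_square)
qed

text \<open>The constant and linear coefficients of \<open>Q 1 h (- h) 0\<close> are
  \<open>C 4 0 0\<close> and \<open>C 3 1 0 - C 3 0 1\<close>; both must vanish because of the zeros
  of \<open>delta_face\<close>.\<close>

lemma quartic_below_delta_face:
  fixes Q :: "real \<Rightarrow> real \<Rightarrow> real \<Rightarrow> real \<Rightarrow> real"
  assumes bound: "\<And>a b c d. Q a b c d ^ 2 \<le> delta_face a b c d"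
    and Q: "\<And>a b c d. Q a b c d =
      (\<Sum>i\<le>4. \<Sum>j\<le>4 - i. \<Sum>k\<le>4 - i - j. C i j k * (a ^ i * b ^ j * c ^ k * d ^ (4 - i - j - k)))"
  shows "\<exists>k2 k3 k4. \<forall>h. Q 1 h (- h) 0 = h ^ 2 * (k2 + k3 * h + k4 * h ^ 2)"
proof -
  have Q_expand: "Q a b c d =
      C 4 0 0 * a ^ 4 + C 0 4 0 * b ^ 4 + C 0 0 4 * c ^ 4 + C 0 0 0 * d ^ 4
      + C 3 1 0 * a ^ 3 * b + C 3 0 1 * a ^ 3 * c + C 3 0 0 * a ^ 3 * d
      + C 1 3 0 * a * b ^ 3 + C 0 3 1 * b ^ 3 * c + C 0 3 0 * b ^ 3 * d
      + C 1 0 3 * a * c ^ 3 + C 0 1 3 * b * c ^ 3 + C 0 0 3 * c ^ 3 * d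
      + C 1 0 0 * a * d ^ 3 + C 0 1 0 * b * d ^ 3 + C 0 0 1 * c * d ^ 3
      + C 2 2 0 * a ^ 2 * b ^ 2 + C 2 0 2 * a ^ 2 * c ^ 2 + C 2 0 0 * a ^ 2 * d ^ 2
      + C 0 2 2 * b ^ 2 * c ^ 2 + C 0 2 0 * b ^ 2 * d ^ 2 + C 0 0 2 * c ^ 2 * d ^ 2
      + C 2 1 1 * a ^ 2 * b * c + C 2 1 0 * a ^ 2 * b * d + C 2 0 1 * a ^ 2 * c * d
      + C 1 2 1 * a * b ^ 2 * c + C 1 2 0 * a * b ^ 2 * d + C 0 2 1 * b ^ 2 * c * d
      + C 1 1 2 * a * b * c ^ 2 + C 1 0 2 * a * c ^ 2 * d + C 0 1 2 * b * c ^ 2 * d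
      + C 1 1 0 * a * b * d ^ 2 + C 1 0 1 * a * c * d ^ 2 + C 0 1 1 * b * c * d ^ 2
      + C 1 1 1 * a * b * c * d" for a b c d
    unfolding Q by (simp add: numeral_eq_Suc atMost_Suc)
  text \<open>The part of \<open>Q\<close> that is antisymmetric in \<open>b, c\<close> has few coefficients, and the zeros of
    \<open>delta_face\<close> (double ones giving first-order conditions) force its coefficient \<open>u0\<close> of
    \<open>a\<^sup>3 (b - c)\<close> to vanish.\<close>
  define R where "R a b c d = Q a b c d - Q a c b d" for a b c d
  define u0 u1 u2 u3 v0 v1 v2 w0 w1 z y0 y1 s where
    "u0 = C 3 1 0 - C 3 0 1" and "u1 = C 2 1 0 - C 2 0 1" and "u2 = C 1 1 0 - C 1 0 1"
    and "u3 = C 0 1 0 - C 0 0 1" and "v0 = C 2 2 0 - C 2 0 2" and "v1 = C 1 2 0 - C 1 0 2"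
    and "v2 = C 0 2 0 - C 0 0 2" and "w0 = C 1 3 0 - C 1 0 3" and "w1 = C 0 3 0 - C 0 0 3"
    and "z = C 0 4 0 - C 0 0 4" and "y0 = C 1 2 1 - C 1 1 2" and "y1 = C 0 2 1 - C 0 1 2"
    and "s = C 0 3 1 - C 0 1 3"
  have R: "R a b c d = (b - c) * (u0 * a ^ 3 + u1 * a ^ 2 * d + u2 * a * d ^ 2 + u3 * d ^ 3)
      + (b ^ 2 - c ^ 2) * (v0 * a ^ 2 + v1 * a * d + v2 * d ^ 2)
      + (b ^ 3 - c ^ 3) * (w0 * a + w1 * d) + z * (b ^ 4 - c ^ 4)
      + (b ^ 2 * c - b * c ^ 2) * (y0 * a + y1 * d) + s * (b ^ 3 * c - b * c ^ 3)" for a b c d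
    unfolding R_def Q_expand u0_def u1_def u2_def u3_def v0_def v1_def v2_def w0_def w1_def
      z_def y0_def y1_def s_def by algebra
  \<comment> \<open>\<open>delta_face\<close> is symmetric in \<open>b, c\<close>, so the bound
    passes to \<open>R\<close> by the parallelogram law.\<close>
  have R_bound: "R a b c d ^ 2 \<le> 4 * delta_face a b c d" for a b c d
  proof -
    have "delta_face a c b d = delta_face a b c d"
      unfolding delta_face_def Let_def by algebra
    then have "Q a b c d ^ 2 \<le> delta_face a b c d" "Q a c b d ^ 2 \<le> delta_face a b c d"
      using bound[of a b c d] bound[of a c b d] by simp_all
    moreover have "R a b c d ^ 2 + (Q a b c d + Q a c b d) ^ 2 = 2 * Q a b c d ^ 2 + 2 * Q a c b d ^ 2"
      unfolding R_def by algebra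
    moreover have "0 \<le> (Q a b c d + Q a c b d) ^ 2"
      by simp
    ultimately show ?thesis
      by linarith
  qed
  \<comment> \<open>The zeros used are points with \<open>f1 = f4 = 0\<close>, coordinate points,
    and permutations of (7,1,1,1). At each, both the derivative along \<open>edge\<close> and
    \<open>p\<close> vanish.\<close>
  have R_zero: "R a b c d = 0" if "delta_face a b c d = 0" for a b c d
    using R_bound[of a b c d] that by simp
  \<comment> \<open>Along a curve on which \<open>delta_face\<close> is of order
    \<open>h ^ 4\<close>, \<open>R\<close> is of order \<open>h ^ 2\<close>. A factor
    \<open>h\<close> of \<open>R\<close> thus leaves a cofactor vanishing at 0.\<close>
  have R_double_zero: "g 0 = 0"
    if cont: "isCont g 0" "isCont k 0" and double: "\<And>h. R (xa h) (xb h) (xc h) (xd h) = h * g h"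
      "\<And>h. delta_face (xa h) (xb h) (xc h) (xd h) = h ^ 4 * k h" for g k xa xb xc xd
  proof -
    have "g h ^ 2 \<le> 4 * h ^ 2 * k h" if "h \<noteq> 0" for h
    proof -
      have "(h * g h) ^ 2 \<le> 4 * (h ^ 4 * k h)"
        using R_bound[of "xa h" "xb h" "xc h" "xd h"] double by simp
      moreover have "(h * g h) ^ 2 = h ^ 2 * g h ^ 2" "4 * (h ^ 4 * k h) = h ^ 2 * (4 * h ^ 2 * k h)"
        by algebra+
      ultimately have "h ^ 2 * g h ^ 2 \<le> h ^ 2 * (4 * h ^ 2 * k h)"
        by simp
      with that show ?thesis by simp
    qed
    moreover have "isCont (\<lambda>h. 4 * h ^ 2 * k h) 0"
      using cont(2) by (intro continuous_intros)
    ultimately have "g 0 ^ 2 \<le> 4 * 0 ^ 2 * k 0"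
      using cont(1) by (intro square_le_at_0[of g "\<lambda>h. 4 * h ^ 2 * k h"]) auto
    then show ?thesis by simp
  qed
  have z: "z = 0"
    using R_zero[of 0 1 0 0] by (simp add: R delta_face_def)
  have "(\<lambda>h. s * ((h - 1) * (2 - h))) 0 = 0"
  proof (rule R_double_zero[where g = "\<lambda>h. s * ((h - 1) * (2 - h))"
      and k = "\<lambda>h. 3136 * (h - 1) ^ 2" and xa = "\<lambda>h. 0" and xb = "\<lambda>h. 1" and xc = "\<lambda>h. h - 1" and xd = "\<lambda>h. 0"])
    \<comment> \<open>The identities for \<open>R\<close> and \<open>delta_face\<close> are stated
      homogeneously in \<open>e, h\<close> and then specialised to \<open>e = 1\<close>; the later
      curves are treated in the same way.\<close>
    have R': "R (0) (e) (h - e) (0) = h * (s * ((h - e) * (2 * e - h)) * e)" for e h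
      unfolding R power_zero_numeral mult_zero_left mult_zero_right add_0_left add_0_right
      using z by algebra
    have delta': "delta_face (0) (e) (h - e) (0) = h ^ 4 * (3136 * e ^ 2 * (h - e) ^ 2)" for e h
      unfolding delta_face_def Let_def by algebra
    show "R (0) (1) (h - 1) (0) = h * (s * ((h - 1) * (2 - h)))" for h
      using R'[where e = 1 and h = h] by simp
    show "delta_face (0) (1) (h - 1) (0) = h ^ 4 * (3136 * (h - 1) ^ 2)" for h
      using delta'[where e = 1 and h = h] by simp
  qed (auto intro!: continuous_intros)
  then have s: "s = 0"
    by simp
  have rel0: "u0 - v0 + w0 = 0"
    using R_zero[of 1 "-1" 0 0] by (simp add: R z delta_face_def)
  have "(\<lambda>h. (h - 1) * (v0 - 2 * w0 + w0 * h)) 0 = 0"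
  proof (rule R_double_zero[where g = "\<lambda>h. (h - 1) * (v0 - 2 * w0 + w0 * h)"
      and k = "\<lambda>h. 3136 * (h - 1) ^ 2" and xa = "\<lambda>h. 1" and xb = "\<lambda>h. h - 1" and xc = "\<lambda>h. 0" and xd = "\<lambda>h. 0"])
    have R': "R (e) (h - e) (0) (0) = h * ((h - e) * ((v0 - 2 * w0) * e ^ 2 + w0 * h * e))" for e h
      unfolding R power_zero_numeral mult_zero_left mult_zero_right add_0_left add_0_right
      using z rel0 by algebra
    have delta': "delta_face (e) (h - e) (0) (0) = h ^ 4 * (3136 * e ^ 2 * (h - e) ^ 2)" for e h
      unfolding delta_face_def Let_def by algebra
    show "R (1) (h - 1) (0) (0) = h * ((h - 1) * (v0 - 2 * w0 + w0 * h))" for h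
      using R'[where e = 1 and h = h] by simp
    show "delta_face (1) (h - 1) (0) (0) = h ^ 4 * (3136 * (h - 1) ^ 2)" for h
      using delta'[where e = 1 and h = h] by simp
  qed (auto intro!: continuous_intros)
  then have u0: "u0 = w0" "v0 = 2 * w0"
    using rel0 by simp_all
  have rel3: "u3 - v2 + w1 = 0"
    using R_zero[of 0 "-1" 0 1] by (simp add: R z delta_face_def)
  have "(\<lambda>h. (h - 1) * (v2 - 2 * w1 + w1 * h)) 0 = 0"
  proof (rule R_double_zero[where g = "\<lambda>h. (h - 1) * (v2 - 2 * w1 + w1 * h)"
      and k = "\<lambda>h. 3136 * (h - 1) ^ 2" and xa = "\<lambda>h. 0" and xb = "\<lambda>h. h - 1" and xc = "\<lambda>h. 0" and xd = "\<lambda>h. 1"])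
    have R': "R (0) (h - e) (0) (e) = h * ((h - e) * ((v2 - 2 * w1) * e ^ 2 + w1 * h * e))" for e h
      unfolding R power_zero_numeral mult_zero_left mult_zero_right add_0_left add_0_right
      using z rel3 by algebra
    have delta': "delta_face (0) (h - e) (0) (e) = h ^ 4 * (3136 * e ^ 2 * (h - e) ^ 2)" for e h
      unfolding delta_face_def Let_def by algebra
    show "R (0) (h - 1) (0) (1) = h * ((h - 1) * (v2 - 2 * w1 + w1 * h))" for h
      using R'[where e = 1 and h = h] by simp
    show "delta_face (0) (h - 1) (0) (1) = h ^ 4 * (3136 * (h - 1) ^ 2)" for h
      using delta'[where e = 1 and h = h] by simp
  qed (auto intro!: continuous_intros)
  then have u3: "u3 = w1" "v2 = 2 * w1"
    using rel3 by simp_all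
  have y: "y0 = w0" "y1 = w1"
    using R_zero[of "-3" 2 1 0] R_zero[of 0 2 1 "-3"] by (simp_all add: R z s u0 u3 delta_face_def)
  have uv: "w1 + u1 = v1" "w0 + u2 = v1"
    using R_zero[of 1 "-3" 0 2] R_zero[of 2 "-3" 0 1] by (simp_all add: R z s u0 u3 delta_face_def)
  have "(\<lambda>h. 2 * (w0 + 7 * u1 + 49 * u2 + 343 * w1) + 4 * (2 * w0 + 7 * v1 + 98 * w1) + (6 + 2 * h ^ 2) * (w0 + 7 * w1) + 2 * (1 - h ^ 2) * (w0 + 7 * w1)) 0 = 0"
  proof (rule R_double_zero[where g = "\<lambda>h. 2 * (w0 + 7 * u1 + 49 * u2 + 343 * w1) + 4 * (2 * w0 + 7 * v1 + 98 * w1) + (6 + 2 * h ^ 2) * (w0 + 7 * w1) + 2 * (1 - h ^ 2) * (w0 + 7 * w1)"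
      and k = "\<lambda>h. 6103440000" and xa = "\<lambda>h. 1" and xb = "\<lambda>h. 1 + h" and xc = "\<lambda>h. 1 - h" and xd = "\<lambda>h. 7"])
    have R': "R (e) (e + h) (e - h) (7 * e) = h * (2 * (w0 + 7 * u1 + 49 * u2 + 343 * w1) * e ^ 3 + 4 * e * (2 * w0 + 7 * v1 + 98 * w1) * e ^ 2 + (6 * e ^ 2 + 2 * h ^ 2) * (w0 + 7 * w1) * e + 2 * (e ^ 2 - h ^ 2) * (w0 + 7 * w1) * e)" for e h
      unfolding R power_zero_numeral mult_zero_left mult_zero_right add_0_left add_0_right
      using z s u0 u3 y by algebra
    have delta': "delta_face (e) (e + h) (e - h) (7 * e) = h ^ 4 * (6103440000 * e ^ 4)" for e h
      unfolding delta_face_def Let_def by algebra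
    show "R (1) (1 + h) (1 - h) (7) = h * (2 * (w0 + 7 * u1 + 49 * u2 + 343 * w1) + 4 * (2 * w0 + 7 * v1 + 98 * w1) + (6 + 2 * h ^ 2) * (w0 + 7 * w1) + 2 * (1 - h ^ 2) * (w0 + 7 * w1))" for h
      using R'[where e = 1 and h = h] by simp
    show "delta_face (1) (1 + h) (1 - h) (7) = h ^ 4 * (6103440000)" for h
      using delta'[where e = 1 and h = h] by simp
  qed (auto intro!: continuous_intros)
  then have "560 * w1 - 40 * w0 + 70 * v1 = 0"
    using uv by simp
  moreover have "(\<lambda>h. 2 * (343 * w0 + 49 * u1 + 7 * u2 + w1) + 4 * (98 * w0 + 7 * v1 + 2 * w1) + (6 + 2 * h ^ 2) * (7 * w0 + w1) + 2 * (1 - h ^ 2) * (7 * w0 + w1)) 0 = 0"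
  proof (rule R_double_zero[where g = "\<lambda>h. 2 * (343 * w0 + 49 * u1 + 7 * u2 + w1) + 4 * (98 * w0 + 7 * v1 + 2 * w1) + (6 + 2 * h ^ 2) * (7 * w0 + w1) + 2 * (1 - h ^ 2) * (7 * w0 + w1)"
      and k = "\<lambda>h. 6103440000" and xa = "\<lambda>h. 7" and xb = "\<lambda>h. 1 + h" and xc = "\<lambda>h. 1 - h" and xd = "\<lambda>h. 1"])
    have R': "R (7 * e) (e + h) (e - h) (e) = h * (2 * (343 * w0 + 49 * u1 + 7 * u2 + w1) * e ^ 3 + 4 * e * (98 * w0 + 7 * v1 + 2 * w1) * e ^ 2 + (6 * e ^ 2 + 2 * h ^ 2) * (7 * w0 + w1) * e + 2 * (e ^ 2 - h ^ 2) * (7 * w0 + w1) * e)" for e h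
      unfolding R power_zero_numeral mult_zero_left mult_zero_right add_0_left add_0_right
      using z s u0 u3 y by algebra
    have delta': "delta_face (7 * e) (e + h) (e - h) (e) = h ^ 4 * (6103440000 * e ^ 4)" for e h
      unfolding delta_face_def Let_def by algebra
    show "R (7) (1 + h) (1 - h) (1) = h * (2 * (343 * w0 + 49 * u1 + 7 * u2 + w1) + 4 * (98 * w0 + 7 * v1 + 2 * w1) + (6 + 2 * h ^ 2) * (7 * w0 + w1) + 2 * (1 - h ^ 2) * (7 * w0 + w1))" for h
      using R'[where e = 1 and h = h] by simp
    show "delta_face (7) (1 + h) (1 - h) (1) = h ^ 4 * (6103440000)" for h
      using delta'[where e = 1 and h = h] by simp
  qed (auto intro!: continuous_intros)
  then have "560 * w0 - 40 * w1 + 70 * v1 = 0"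
    using uv by simp
  moreover have "80 * w0 + 80 * w1 + 10 * v1 = 0"
    using R_zero[of 1 7 1 1] uv by (simp add: R z s u0 u3 y delta_face_def)
  \<comment> \<open>The three equations in \<open>w0, w1, v1\<close> are independent, so
    \<open>w0 = 0\<close>, and \<open>u0 = w0\<close>.\<close>
  ultimately have "u0 = 0"
    using u0 by linarith
  have "Q 1 0 0 0 = 0"
    using bound[of 1 0 0 0] by (simp add: delta_face_def)
  then have "C 4 0 0 = 0"
    by (simp add: Q_expand)
  define k2 k3 k4 where "k2 = C 2 2 0 - C 2 1 1 + C 2 0 2"
    and "k3 = C 1 3 0 - C 1 2 1 + C 1 1 2 - C 1 0 3"
    and "k4 = C 0 4 0 - C 0 3 1 + C 0 2 2 - C 0 1 3 + C 0 0 4"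
  have "Q e h (- h) 0 = C 4 0 0 * e ^ 4 + u0 * e ^ 3 * h + h ^ 2 * (k2 * e ^ 2 + k3 * h * e + k4 * h ^ 2)"
    for e h
    unfolding Q_expand u0_def k2_def k3_def k4_def power_zero_numeral mult_zero_left mult_zero_right
      add_0_left add_0_right by algebra
  from this[where e = 1] have "Q 1 h (- h) 0 = h ^ 2 * (k2 + k3 * h + k4 * h ^ 2)" for h
    using \<open>u0 = 0\<close> \<open>C 4 0 0 = 0\<close> by simp
  then show ?thesis
    by (intro exI[of _ k2] exI[of _ k3] exI[of _ k4] allI)
qed

lemma not_sos_Delta_edge: "\<not> sos (Delta edge edge (pform Var))"
proof
  assume "sos (Delta edge edge (pform Var))"
  then obtain qs where qs: "Delta edge edge (pform Var) = (\<Sum>q\<leftarrow>qs. q ^ 2)"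
    by (auto simp: sos_def)
  have sum: "delta_face a b c d = (\<Sum>q\<leftarrow>qs. eval q (face a b c d) ^ 2)" for a b c d
    unfolding eval_Delta_edge_face[symmetric] qs
    by (simp add: eval_def eval_hom.subst_sum_list eval_hom.subst_power o_def)
  have le: "eval q (face a b c d) ^ 2 \<le> delta_face a b c d" if "q \<in> set qs" for q a b c d
    unfolding sum using that
    by (intro member_le_sum_list) auto
  have homog: "delta_face (t * a) (t * b) (t * c) (t * d) = (t ^ 4) ^ 2 * delta_face a b c d" for t a b c d
    unfolding delta_face_def Let_def by algebra
  have "\<exists>K. \<forall>h. \<bar>h\<bar> \<le> 1 \<longrightarrow> eval q (face 1 h (- h) 0) ^ 2 \<le> K * h ^ 4"
    if q: "q \<in> set qs" for q
  proof -
    obtain C where C: "\<forall>a b c d. eval q (face a b c d) =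
        (\<Sum>i\<le>4. \<Sum>j\<le>4 - i. \<Sum>k\<le>4 - i - j. C i j k * (a ^ i * b ^ j * c ^ k * d ^ (4 - i - j - k)))"
      using eval_quartic_on_face[of q delta_face, OF le[OF q] homog] by (rule exE)
    from quartic_below_delta_face[OF le[OF q] C[rule_format]] obtain k2 k3 k4
      where k: "\<forall>h. eval q (face 1 h (- h) 0) = h ^ 2 * (k2 + k3 * h + k4 * h ^ 2)"
      by (elim exE)
    have "eval q (face 1 h (- h) 0) ^ 2 \<le> (\<bar>k2\<bar> + \<bar>k3\<bar> + \<bar>k4\<bar>) ^ 2 * h ^ 4" if "\<bar>h\<bar> \<le> 1" for h
    proof -
      have "\<bar>h\<bar> ^ 2 \<le> 1" using that by (simp add: abs_square_le_1)
      have "\<bar>k2 + k3 * h + k4 * h ^ 2\<bar> \<le> \<bar>k2\<bar> + \<bar>k3\<bar> * \<bar>h\<bar> + \<bar>k4\<bar> * \<bar>h\<bar> ^ 2"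
        by (rule order_trans[OF abs_triangle_ineq] add_mono order_trans[OF abs_triangle_ineq] order_refl
            | simp add: abs_mult)+
      also have "\<dots> \<le> \<bar>k2\<bar> + \<bar>k3\<bar> + \<bar>k4\<bar>"
        using that \<open>\<bar>h\<bar> ^ 2 \<le> 1\<close> by (intro add_mono mult_left_le) simp_all
      finally have "(k2 + k3 * h + k4 * h ^ 2) ^ 2 \<le> (\<bar>k2\<bar> + \<bar>k3\<bar> + \<bar>k4\<bar>) ^ 2"
        by (subst power2_abs[symmetric]) (intro power_mono, simp_all)
      then have "(h ^ 2) ^ 2 * (k2 + k3 * h + k4 * h ^ 2) ^ 2 \<le> (h ^ 2) ^ 2 * (\<bar>k2\<bar> + \<bar>k3\<bar> + \<bar>k4\<bar>) ^ 2"
        by (intro mult_left_mono) simp_all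
      then show ?thesis
        unfolding k[rule_format] by (simp add: power_mult_distrib mult.commute flip: power_mult)
    qed
    then show ?thesis by blast
  qed
  then obtain K where K: "\<And>q h. q \<in> set qs \<Longrightarrow> \<bar>h\<bar> \<le> 1 \<Longrightarrow> eval q (face 1 h (- h) 0) ^ 2 \<le> K q * h ^ 4"
    by metis
  define B where "B = (\<Sum>q\<leftarrow>qs. K q)"
  \<comment> \<open>Along \<open>(1, h, - h, 0)\<close> every summand is of order
    \<open>h ^ 4\<close>, hence so is the finite sum, against a term of order \<open>h ^ 2\<close>
    on the left.\<close>
  have "1658496 * h ^ 4 + 2058 * h ^ 2 \<le> B * h ^ 4" if "\<bar>h\<bar> \<le> 1" for h
  proof -
    have "1658496 * (e ^ 4 * h ^ 4) + 2058 * (e ^ 6 * h ^ 2)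
        = delta_face e h (- h) 0" for e
      unfolding delta_face_def Let_def by algebra
    from this[of 1] have "1658496 * h ^ 4 + 2058 * h ^ 2 = delta_face 1 h (- h) 0"
      by simp
    also have "\<dots> \<le> (\<Sum>q\<leftarrow>qs. K q * h ^ 4)"
      unfolding sum using K that by (intro sum_list_mono)
    also have "\<dots> = B * h ^ 4"
      by (simp add: B_def sum_list_mult_const)
    finally show ?thesis .
  qed
  \<comment> \<open>Writing 2058 as a square gives the shape of \<open>square_le_at_0\<close>; the
    limit at 0 then yields 2058 \<le> 0.\<close>
  then have bound: "sqrt 2058 ^ 2 \<le> (B - 1658496) * h ^ 2" if "h \<noteq> 0" "\<bar>h\<bar> < 1" for h
  proof -
    have "h ^ 2 * sqrt 2058 ^ 2 \<le> h ^ 2 * ((B - 1658496) * h ^ 2)"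
      using \<open>\<And>h. \<bar>h\<bar> \<le> 1 \<Longrightarrow> 1658496 * h ^ 4 + 2058 * h ^ 2 \<le> B * h ^ 4\<close>[of h] that
      by (simp add: algebra_simps eval_nat_numeral)
    with that show ?thesis by simp
  qed
  have "sqrt 2058 ^ 2 \<le> (B - 1658496) * 0 ^ 2"
    by (rule square_le_at_0[of "\<lambda>_. sqrt 2058" "\<lambda>h. (B - 1658496) * h ^ 2"])
      (use bound in \<open>auto intro!: continuous_intros\<close>)
  then show False by simp
qed

theorem theorem1p12:
  fixes p :: "5 mpoly"
  assumes "p = 4500 * esym 5 - 220 * esym 1 * esym 4 + 7 * esym 1 ^ 2 * esym 3"
  shows "symmetric_hyperbolic p \<and>
    ((\<exists>T. is_associated_operator 5 p T) \<and>
     (\<forall>T. is_associated_operator 5 p T \<longrightarrow> \<not> extendable 5 5 T)) \<and>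
    sos (Delta 1 1 p) \<and>
    \<not> weakly_sos_hyperbolic p"
proof -
  have p: "p = pform Var"
    by (simp only: assms pform_def esym_eq_elem_sym)
  have "symmetric_hyperbolic p"
    unfolding p symmetric_hyperbolic_def by (intro conjI symmetric_pform hyperbolic_pform)
  moreover have "\<exists>T. is_associated_operator 5 p T"
    unfolding p by (rule exI, rule is_associated_operator_diag_op)
  moreover have "\<forall>T. is_associated_operator 5 p T \<longrightarrow> \<not> extendable 5 5 T"
    unfolding p using not_extendable by blast
  moreover have "sos (Delta 1 1 p)"
    unfolding p by (rule sos_Delta_1_1_pform)
  moreover have "\<not> weakly_sos_hyperbolic p"
    unfolding p weakly_sos_hyperbolic_def using edge_in_cone not_sos_Delta_edge by blast
  ultimately show ?thesis
    by (intro conjI)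
qed

end
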